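(* Let $K$ be an algebraically closed field of characteristic zero and let $A$ be an artinian Gorenstein standard graded $K$-algebra of socle degree $d$ whose Sperner number is at most $d+1$. Then $A$ satisfies the weak Lefschetz property.
   Context: A standard graded artinian $K$-algebra is $A=R/I$ with $R=K[x_1,\dots,x_n]$ (standard grading, any $n$) and $I$ a homogeneous ideal such that $\dim_K A<\infty$. Its $h$-vector is $(h_0,\dots,h_d)$ with $h_i=\dim_K[A]_i>0$ for $0\le i\le d$, where $d$ is the largest degree in which $A$ is nonzero; $d$ is called the socle degree. $A$ is Gorenstein if its socle is one-dimensional, concentrated in degree $d$ (then its $h$-vector is symmetric, $h_i=h_{d-i}$). The Sperner number of $A$ is $\max_i h_i$. $A$ has the weak Lefschetz property (WLP) if there is a linear form $\ell\in[A]_1$ such that for every integer $i\ge 0$ the multiplication map $\times\ell\colon[A]_i\to[A]_{i+1}$ has maximal rank (i.e. is injective or surjective). *)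

theory Defs
  imports
    "HOL-Algebra.QuotRing"
    "HOL-Algebra.Embedded_Algebras"
    "HOL-Library.Poly_Mapping"
    "HOL-Computational_Algebra.Polynomial"
begin

text \<open>
  A polynomial in the variables \<open>x\<^sub>0, x\<^sub>1, \<dots>\<close> is a finitely supported map from exponent vectors
  to coefficients; multiplication on this type is convolution, i.e. the product of polynomials.
\<close>

type_synonym 'k mpoly = "(nat \<Rightarrow>\<^sub>0 nat) \<Rightarrow>\<^sub>0 'k"

definition mon_degree :: "(nat \<Rightarrow>\<^sub>0 nat) \<Rightarrow> nat" where
  "mon_degree m = (\<Sum>i\<in>Poly_Mapping.keys m. Poly_Mapping.lookup m i)"

text \<open>The ring \<open>K[x\<^sub>0, \<dots>, x\<^sub>n\<^sub>-\<^sub>1]\<close>; the case \<open>n = 0\<close>, where it is \<open>K\<close>, is included.\<close>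

definition poly_ring :: "nat \<Rightarrow> 'k::field mpoly ring" where
  "poly_ring n =
     \<lparr>carrier = {p. \<forall>m\<in>Poly_Mapping.keys p. Poly_Mapping.keys m \<subseteq> {..<n}},
      monoid.mult = (*), one = 1, zero = 0, add = (+)\<rparr>"

definition poly_comp :: "nat \<Rightarrow> nat \<Rightarrow> 'k::field mpoly set" where
  "poly_comp n i = {p \<in> carrier (poly_ring n). \<forall>m\<in>Poly_Mapping.keys p. mon_degree m = i}"

definition homogeneous_ideal :: "nat \<Rightarrow> 'k::field mpoly set \<Rightarrow> bool" where
  "homogeneous_ideal n I \<longleftrightarrow>
     ideal I (poly_ring n) \<and> (\<exists>S \<subseteq> (\<Union>i. poly_comp n i). I = Idl\<^bsub>poly_ring n\<^esub> S)"

text \<open>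
  From here on, \<open>A = R / I\<close> is determined by the number \<open>n\<close> of variables and the homogeneous
  ideal \<open>I\<close>. Its elements are the cosets of \<open>I\<close>.
\<close>

abbreviation quot_alg :: "nat \<Rightarrow> 'k::field mpoly set \<Rightarrow> 'k mpoly set ring" where
  "quot_alg n I \<equiv> poly_ring n Quot I"

definition scalars :: "nat \<Rightarrow> 'k::field mpoly set \<Rightarrow> 'k mpoly set set" where
  "scalars n I = (\<lambda>c. I +>\<^bsub>poly_ring n\<^esub> Poly_Mapping.single 0 c) ` UNIV"

definition graded_comp :: "nat \<Rightarrow> 'k::field mpoly set \<Rightarrow> nat \<Rightarrow> 'k mpoly set set" where
  "graded_comp n I i = (\<lambda>p. I +>\<^bsub>poly_ring n\<^esub> p) ` poly_comp n i"

definition artinian_quot :: "nat \<Rightarrow> 'k::field mpoly set \<Rightarrow> bool" where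
  "artinian_quot n I \<longleftrightarrow>
     ring.finite_dimension (quot_alg n I) (scalars n I) (carrier (quot_alg n I))"

definition hilb :: "nat \<Rightarrow> 'k::field mpoly set \<Rightarrow> nat \<Rightarrow> nat" where
  "hilb n I i = ring.dim (quot_alg n I) (scalars n I) (graded_comp n I i)"

text \<open>
  The condition that \<open>d\<close> is the largest degree in which \<open>A\<close> is nonzero. In particular it forces
  \<open>A \<noteq> 0\<close>.
\<close>

definition is_socle_degree :: "nat \<Rightarrow> 'k::field mpoly set \<Rightarrow> nat \<Rightarrow> bool" where
  "is_socle_degree n I d \<longleftrightarrow>
     graded_comp n I d \<noteq> {\<zero>\<^bsub>quot_alg n I\<^esub>} \<and> (\<forall>j>d. graded_comp n I j = {\<zero>\<^bsub>quot_alg n I\<^esub>})"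

definition sperner_number :: "nat \<Rightarrow> 'k::field mpoly set \<Rightarrow> nat \<Rightarrow> nat" where
  "sperner_number n I d = Max (hilb n I ` {0..d})"

text \<open>The image in \<open>A\<close> of the ideal generated by the variables.\<close>

definition irrelevant_ideal :: "nat \<Rightarrow> 'k::field mpoly set \<Rightarrow> 'k mpoly set set" where
  "irrelevant_ideal n I =
     (\<lambda>p. I +>\<^bsub>poly_ring n\<^esub> p) ` {p \<in> carrier (poly_ring n). Poly_Mapping.lookup p 0 = 0}"

definition socle :: "nat \<Rightarrow> 'k::field mpoly set \<Rightarrow> 'k mpoly set set" where
  "socle n I =
     {a \<in> carrier (quot_alg n I).
        \<forall>x\<in>irrelevant_ideal n I. x \<otimes>\<^bsub>quot_alg n I\<^esub> a = \<zero>\<^bsub>quot_alg n I\<^esub>}"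

definition gorenstein_quot :: "nat \<Rightarrow> 'k::field mpoly set \<Rightarrow> nat \<Rightarrow> bool" where
  "gorenstein_quot n I d \<longleftrightarrow>
     ring.dimension (quot_alg n I) 1 (scalars n I) (socle n I) \<and> socle n I \<subseteq> graded_comp n I d"

definition weak_lefschetz :: "nat \<Rightarrow> 'k::field mpoly set \<Rightarrow> bool" where
  "weak_lefschetz n I \<longleftrightarrow>
     (\<exists>l\<in>graded_comp n I 1. \<forall>i.
        inj_on (\<lambda>a. l \<otimes>\<^bsub>quot_alg n I\<^esub> a) (graded_comp n I i) \<or>
        (\<lambda>a. l \<otimes>\<^bsub>quot_alg n I\<^esub> a) ` graded_comp n I i = graded_comp n I (Suc i))"

end

theory Submission
  imports Defs
begin

text \<open>
  Let \<open>A\<close> be the algebra and \<open>d\<close> its socle degree. By Macaulay duality \<open>A\<close> is determined by a linear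
  functional \<open>\<phi>\<close> on the forms of degree \<open>d\<close>: a form \<open>p\<close> is zero in \<open>A\<close> if and only if \<open>\<phi> (p * q) = 0\<close> for all
  \<open>q\<close>, and \<open>\<phi>\<close> induces perfect pairings between \<open>A\<^sub>i\<close> and \<open>A\<^bsub>d-i\<^esub>\<close>. By this duality and because injectivity
  passes to lower degrees, it suffices for \<open>d > 0\<close> to find a linear form that is injective on \<open>A\<^sub>j\<close> for
  \<open>j = (d - 1) div 2\<close>.

  Choose \<open>l\<close> such that multiplication by \<open>l\<close> on \<open>A\<^sub>j\<close> has maximal rank, and suppose that it kills some nonzero
  \<open>v\<^sub>0\<close> in \<open>A\<^sub>j\<close>. Let \<open>l'\<close> be any other linear form. Since the rank of \<open>l + t * l'\<close> never exceeds that of \<open>l\<close>,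
  the element \<open>v\<^sub>0\<close> extends to a power series in the kernel of \<open>l + t * l'\<close>; that is, there is an infinite
  chain with \<open>l * v\<^bsub>i+1\<^esub> = l' * v\<^sub>i\<close> (lemma \<open>kernel_lift\<close>). Two things hold for such a chain.
  First, \<open>l * v\<^sub>a * v\<^sub>b = 0\<close> for all \<open>a\<close> and \<open>b\<close>, since indices can be shifted between the factors until
  \<open>l * v\<^sub>0\<close> appears (lemma \<open>chain_isotropic\<close>). Second, if \<open>l' ^ N * v\<^sub>0\<close> is nonzero, then the \<open>N\<close> elements
  \<open>l * v\<^sub>1, \<dots>, l * v\<^sub>N\<close> are independent, and so are \<open>v\<^sub>0, \<dots>, v\<^sub>N\<close> (lemma \<open>chain_lin_indep\<close>). In
  characteristic zero powers of linear forms span, so \<open>l'\<close> can be chosen to make this true for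
  \<open>N = d - j\<close>.

  If \<open>d = 2 * j + 1\<close>, then \<open>l * v\<^sub>1, \<dots>, l * v\<^sub>N\<close> lie in the degree dual to \<open>A\<^sub>j\<close> and are orthogonal to
  \<open>v\<^sub>0, \<dots>, v\<^sub>N\<close>. Together with dual elements of the latter they are \<open>2 * N + 1 = d + 2\<close> independent
  elements of one degree, contradicting the bound \<open>d + 1\<close>. If \<open>d = 2 * j + 2\<close>, the elements \<open>l * v\<^sub>i\<close> are one
  degree too low. The algebra \<open>A / (0 : l)\<close>, which is isomorphic to the ideal generated by \<open>l\<close>, has odd socle
  degree \<open>d - 1\<close>, and its dimension in degree \<open>j + 1\<close> is at most \<open>d\<close>, so the odd case gives a linear form \<open>x\<close>
  that is injective on the multiples \<open>l * A\<^sub>j\<close>. The elements \<open>x * l * v\<^sub>i\<close> then lead to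
  \<open>2 * N + 1 = d + 3\<close> independent elements of one degree.
\<close>

section \<open>Linearly independent families of functions\<close>

definition lin_indep_on :: "'q set \<Rightarrow> nat \<Rightarrow> (nat \<Rightarrow> 'q \<Rightarrow> 'k::field) \<Rightarrow> bool" where
  "lin_indep_on Q m f \<longleftrightarrow>
     (\<forall>c. (\<forall>q\<in>Q. (\<Sum>a<m. c a * f a q) = 0) \<longrightarrow> (\<forall>a<m. c a = 0))"

abbreviation lin_indep :: "nat \<Rightarrow> (nat \<Rightarrow> 'q \<Rightarrow> 'k::field) \<Rightarrow> bool" where
  "lin_indep \<equiv> lin_indep_on UNIV"

lemma lin_indep_onI:
  assumes "\<And>c a. (\<And>q. q \<in> Q \<Longrightarrow> (\<Sum>a<m. c a * f a q) = 0) \<Longrightarrow> a < m \<Longrightarrow> c a = 0"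
  shows "lin_indep_on Q m f"
  using assms unfolding lin_indep_on_def by blast

lemma lin_indep_onD:
  assumes "lin_indep_on Q m f" "\<And>q. q \<in> Q \<Longrightarrow> (\<Sum>a<m. c a * f a q) = 0" "a < m"
  shows "c a = 0"
  using assms unfolding lin_indep_on_def by blast

lemma lin_indep_on_cong:
  assumes "\<And>a q. a < m \<Longrightarrow> q \<in> Q \<Longrightarrow> f a q = g a q"
  shows "lin_indep_on Q m f \<longleftrightarrow> lin_indep_on Q m g"
  unfolding lin_indep_on_def using assms by simp

lemma lin_indep_on_Suc:
  assumes indep: "lin_indep_on Q m f"
    and new: "\<And>c. \<exists>q\<in>Q. f m q \<noteq> (\<Sum>a<m. c a * f a q)"
  shows "lin_indep_on Q (Suc m) f"
proof (rule lin_indep_onI)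
  fix c a assume *: "\<And>q. q \<in> Q \<Longrightarrow> (\<Sum>a<Suc m. c a * f a q) = 0" and a: "a < Suc m"
  have cm: "c m = 0"
  proof (rule ccontr)
    assume "c m \<noteq> 0"
    then have "f m q = (\<Sum>a<m. (- c a / c m) * f a q)" if "q \<in> Q" for q
    proof -
      have "f m q = - (\<Sum>a<m. c a * f a q) / c m"
        using *[OF that] \<open>c m \<noteq> 0\<close> by (simp add: field_simps add_eq_0_iff)
      then show ?thesis by (simp add: sum_divide_distrib sum_negf)
    qed
    then show False using new[of "\<lambda>a. - c a / c m"] by auto
  qed
  have "\<forall>a<m. c a = 0"
    using lin_indep_onD[OF indep, of c] * cm by simp
  with cm a show "c a = 0" by (auto simp: less_Suc_eq)
qed

lemma lin_indep_on_butlast: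
  assumes "lin_indep_on Q (Suc m) f"
  shows "lin_indep_on Q m f"
proof (rule lin_indep_onI)
  fix c a assume *: "\<And>q. q \<in> Q \<Longrightarrow> (\<Sum>a<m. c a * f a q) = 0" and a: "a < m"
  have "(\<Sum>a<Suc m. (c(m := 0)) a * f a q) = 0" if "q \<in> Q" for q
    using *[OF that] by simp
  from lin_indep_onD[OF assms this, of a] a show "c a = 0" by simp
qed

lemma sum_lessThan_add:
  fixes g :: "nat \<Rightarrow> 'a::comm_monoid_add"
  shows "sum g {..<m + w} = sum g {..<m} + (\<Sum>b<w. g (m + b))"
  by (induction w) (simp_all add: add.assoc)

text \<open>
  Evaluation at the points \<open>y b\<close> first kills the coefficients of \<open>f\<close>, since \<open>g\<close> is invisible there.
\<close>

lemma lin_indep_dual_append: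
  fixes f g :: "nat \<Rightarrow> 'q \<Rightarrow> 'k::field"
  assumes dual: "\<And>a b. a < m \<Longrightarrow> b < m \<Longrightarrow> f a (y b) = (if a = b then 1 else 0)"
    and orth: "\<And>a b. a < w \<Longrightarrow> b < m \<Longrightarrow> g a (y b) = 0"
    and indep: "lin_indep w g"
  shows "lin_indep (m + w) (\<lambda>a. if a < m then f a else g (a - m))"
proof (rule lin_indep_onI)
  fix c a
  assume "\<And>q. q \<in> UNIV \<Longrightarrow> (\<Sum>a<m + w. c a * (if a < m then f a else g (a - m)) q) = 0"
    and a: "a < m + w"
  then have *: "(\<Sum>a<m. c a * f a q) + (\<Sum>a<w. c (m + a) * g a q) = 0" for q
    by (simp add: sum_lessThan_add)
  have c: "c b = 0" if "b < m" for b
  proof -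
    have "(\<Sum>a<m. c a * f a (y b)) = (\<Sum>a<m. if a = b then c a else 0)"
      using that by (intro sum.cong) (auto simp: dual)
    then show ?thesis using *[of "y b"] that by (simp add: orth)
  qed
  then have "(\<Sum>a<w. c (m + a) * g a q) = 0" for q using *[of q] by simp
  from lin_indep_onD[OF indep this] have "c (m + a) = 0" if "a < w" for a using that by blast
  from this[of "a - m"] c a show "c a = 0" by (cases "a < m") auto
qed

text \<open>
  Linear independence is an open condition. The proof eliminates without dividing: at a point where
  the last function does not vanish for the parameter 0, cross-multiplication keeps the other
  functions polynomial in the parameter, and the step spoils only the roots of one nonzero polynomial.
\<close>

lemma lin_indep_perturb:
  fixes f :: "nat \<Rightarrow> 'q \<Rightarrow> 'k::field poly"
  assumes "lin_indep m (\<lambda>a q. poly (f a q) 0)"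
  shows "finite {t. \<not> lin_indep m (\<lambda>a q. poly (f a q) t)}"
  using assms
proof (induction m arbitrary: f)
  case 0
  then show ?case by (simp add: lin_indep_on_def)
next
  case (Suc m)
  have "\<exists>q0. poly (f m q0) 0 \<noteq> 0"
  proof (rule ccontr)
    assume "\<nexists>q0. poly (f m q0) 0 \<noteq> 0"
    then have "(\<Sum>a<Suc m. (if a = m then 1 else 0) * poly (f a q) 0) = 0" for q
      by simp
    from lin_indep_onD[OF Suc.prems this, of m] show False by simp
  qed
  then obtain q0 where q0: "poly (f m q0) 0 \<noteq> 0" by blast
  define g where "g a q = f m q0 * f a q - f a q0 * f m q" for a q
  have "lin_indep m (\<lambda>a q. poly (g a q) 0)"
  proof (rule lin_indep_onI)
    fix c a assume *: "\<And>q. q \<in> UNIV \<Longrightarrow> (\<Sum>a<m. c a * poly (g a q) 0) = 0" and a: "a < m"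
    define e where "e b = (if b < m then c b * poly (f m q0) 0
        else - (\<Sum>a<m. c a * poly (f a q0) 0))" for b
    have "(\<Sum>a<Suc m. e a * poly (f a q) 0) = 0" for q
    proof -
      have "(\<Sum>a<Suc m. e a * poly (f a q) 0) = (\<Sum>a<m. c a * poly (g a q) 0)"
        by (simp add: e_def g_def algebra_simps sum_subtractf sum_distrib_left sum_distrib_right)
      then show ?thesis using * by simp
    qed
    from lin_indep_onD[OF Suc.prems this, of a] a q0 show "c a = 0" by (simp add: e_def)
  qed
  from Suc.IH[OF this] have fin: "finite {t. \<not> lin_indep m (\<lambda>a q. poly (g a q) t)}" .
  have "f m q0 \<noteq> 0" using q0 by auto
  then have fin': "finite {t. poly (f m q0) t = 0}" by (rule poly_roots_finite)
  have "lin_indep (Suc m) (\<lambda>a q. poly (f a q) t)"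
    if t: "lin_indep m (\<lambda>a q. poly (g a q) t)" "poly (f m q0) t \<noteq> 0" for t
  proof (rule lin_indep_onI)
    fix c a assume *: "\<And>q. q \<in> UNIV \<Longrightarrow> (\<Sum>a<Suc m. c a * poly (f a q) t) = 0" and a: "a < Suc m"
    have "(\<Sum>a<m. c a * poly (g a q) t) = 0" for q
    proof -
      have "(\<Sum>a<m. c a * poly (g a q) t)
          = poly (f m q0) t * (\<Sum>a<m. c a * poly (f a q) t)
            - poly (f m q) t * (\<Sum>a<m. c a * poly (f a q0) t)"
        by (simp add: g_def algebra_simps sum_subtractf sum_distrib_left)
      moreover have "(\<Sum>a<m. c a * poly (f a q') t) = - c m * poly (f m q') t" for q'
        using *[of q'] by (simp add: add_eq_0_iff2)
      ultimately show ?thesis by simp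
    qed
    from lin_indep_onD[OF t(1) this] have c: "\<forall>a<m. c a = 0" by blast
    then have "c m = 0" using *[of q0] t(2) by simp
    with c a show "c a = 0" by (auto simp: less_Suc_eq)
  qed
  then have "{t. \<not> lin_indep (Suc m) (\<lambda>a q. poly (f a q) t)}
      \<subseteq> {t. \<not> lin_indep m (\<lambda>a q. poly (g a q) t)} \<union> {t. poly (f m q0) t = 0}"
    by blast
  then show ?case using fin fin' by (meson finite_UnI finite_subset)
qed

section \<open>Forms\<close>

abbreviation const :: "'k \<Rightarrow> 'k::field mpoly" where
  "const c \<equiv> Poly_Mapping.single 0 c"

lemma const_add: "const (a + b) = const a + const b"
  by (rule single_add)

lemma const_mult: "const (a * b) = const a * const b"
  by (simp add: mult_single)

lemma lookup_const_mult [simp]: "Poly_Mapping.lookup (const c * p) m = c * Poly_Mapping.lookup p m"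
  by (simp flip: mult_map_scale_conv_mult add: map.rep_eq when_def)

lemma mpoly_eq_sum_single:
  "p = (\<Sum>m\<in>Poly_Mapping.keys p. Poly_Mapping.single m (Poly_Mapping.lookup p m))"
  by (rule poly_mapping_eqI)
    (simp add: lookup_sum lookup_single when_def in_keys_iff)

lemma keys_add_nat:
  fixes m m' :: "nat \<Rightarrow>\<^sub>0 nat"
  shows "Poly_Mapping.keys (m + m') = Poly_Mapping.keys m \<union> Poly_Mapping.keys m'"
  by (auto simp: in_keys_iff lookup_add)

lemma mon_degree_superset:
  assumes "finite A" "Poly_Mapping.keys m \<subseteq> A"
  shows "mon_degree m = (\<Sum>i\<in>A. Poly_Mapping.lookup m i)"
  unfolding mon_degree_def using assms
  by (intro sum.mono_neutral_left) (auto simp: in_keys_iff)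

lemma mon_degree_add: "mon_degree (m + m') = mon_degree m + mon_degree m'"
proof -
  let ?A = "Poly_Mapping.keys m \<union> Poly_Mapping.keys m'"
  have "mon_degree (m + m') = (\<Sum>i\<in>?A. Poly_Mapping.lookup m i + Poly_Mapping.lookup m' i)"
    by (subst mon_degree_superset[of ?A]) (auto simp: keys_add_nat lookup_add)
  also have "\<dots> = mon_degree m + mon_degree m'"
    by (simp add: sum.distrib mon_degree_superset[of ?A])
  finally show ?thesis .
qed

lemma mon_degree_0 [simp]: "mon_degree 0 = 0"
  by (simp add: mon_degree_def)

lemma mon_degree_eq_0_iff: "mon_degree m = 0 \<longleftrightarrow> m = 0"
  by (auto simp: mon_degree_def in_keys_iff intro!: poly_mapping_eqI)

lemma mon_degree_single [simp]: "mon_degree (Poly_Mapping.single i k) = k"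
  by (simp add: mon_degree_def)

lemma mem_poly_ring_iff:
  "p \<in> carrier (poly_ring n) \<longleftrightarrow> (\<forall>m\<in>Poly_Mapping.keys p. Poly_Mapping.keys m \<subseteq> {..<n})"
  by (simp add: poly_ring_def)

lemma mem_poly_comp_iff:
  "p \<in> poly_comp n i \<longleftrightarrow>
     (\<forall>m\<in>Poly_Mapping.keys p. Poly_Mapping.keys m \<subseteq> {..<n} \<and> mon_degree m = i)"
  by (auto simp: poly_comp_def mem_poly_ring_iff)

lemma poly_comp_0 [simp]: "0 \<in> poly_comp n i"
  by (simp add: mem_poly_comp_iff)

lemma poly_comp_add: "p \<in> poly_comp n i \<Longrightarrow> q \<in> poly_comp n i \<Longrightarrow> p + q \<in> poly_comp n i"
  using Poly_Mapping.keys_add[of p q] by (auto simp: mem_poly_comp_iff)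

lemma poly_comp_single:
  "Poly_Mapping.keys m \<subseteq> {..<n} \<Longrightarrow> mon_degree m = i \<Longrightarrow> Poly_Mapping.single m c \<in> poly_comp n i"
  by (auto simp: mem_poly_comp_iff)

lemma poly_comp_mult:
  assumes "p \<in> poly_comp n i" "q \<in> poly_comp n j"
  shows "p * q \<in> poly_comp n (i + j)"
  unfolding mem_poly_comp_iff
proof
  fix m assume "m \<in> Poly_Mapping.keys (p * q)"
  then obtain a b where "m = a + b" "a \<in> Poly_Mapping.keys p" "b \<in> Poly_Mapping.keys q"
    using keys_mult[of p q] by blast
  then show "Poly_Mapping.keys m \<subseteq> {..<n} \<and> mon_degree m = i + j"
    using assms by (auto simp: mem_poly_comp_iff keys_add_nat mon_degree_add)
qed

lemma poly_comp_const: "p \<in> poly_comp n i \<Longrightarrow> const c * p \<in> poly_comp n i"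
  using poly_comp_mult[of "const c" n 0 p i] poly_comp_single[of 0 n 0 c] by simp

lemma poly_comp_sum:
  "(\<And>x. x \<in> A \<Longrightarrow> f x \<in> poly_comp n i) \<Longrightarrow> sum f A \<in> poly_comp n i"
  by (induction A rule: infinite_finite_induct) (auto intro: poly_comp_add)

lemma poly_comp_minus:
  assumes "p \<in> poly_comp n i" "q \<in> poly_comp n i" shows "p - q \<in> poly_comp n i"
  using poly_comp_add[OF assms(1) poly_comp_const[OF assms(2), of "- 1"]]
  by (simp add: single_uminus)

lemma monomial_factor:
  assumes "mon_degree m = Suc r" "Poly_Mapping.keys m \<subseteq> {..<n}"
  obtains i m' where "i < n" "m = Poly_Mapping.single i 1 + m'" "mon_degree m' = r"
    "Poly_Mapping.keys m' \<subseteq> {..<n}"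
proof -
  have "m \<noteq> 0" using assms(1) by auto
  then obtain i where i: "i \<in> Poly_Mapping.keys m"
    by (metis ex_in_conv keys_eq_empty)
  define m' where "m' = m - Poly_Mapping.single i 1"
  have eq: "m = Poly_Mapping.single i 1 + m'"
    using i by (intro poly_mapping_eqI)
      (auto simp: m'_def lookup_add lookup_minus lookup_single when_def in_keys_iff)
  have "mon_degree m' = r"
    using assms(1) unfolding eq mon_degree_add by simp
  moreover have "Poly_Mapping.keys m' \<subseteq> {..<n}"
    using assms(2) unfolding eq keys_add_nat by simp
  ultimately show ?thesis using that[of i m'] i assms(2) eq by auto
qed

section \<open>Linear functionals on forms\<close>

locale poly_functional =
  fixes \<phi> :: "'k::field mpoly \<Rightarrow> 'k"
  assumes add: "\<phi> (p + q) = \<phi> p + \<phi> q"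
    and scale: "\<phi> (const c * p) = c * \<phi> p"
begin

lemma zero [simp]: "\<phi> 0 = 0"
  using scale[of 0 0] by simp

lemma sum: "\<phi> (sum f A) = (\<Sum>x\<in>A. \<phi> (f x))"
  by (induction A rule: infinite_finite_induct) (auto simp: add)

lemma diff: "\<phi> (p - q) = \<phi> p - \<phi> q"
  using add[of "p - q" q] by simp

lemma combination: "\<phi> (\<Sum>a\<in>A. const (c a) * v a) = (\<Sum>a\<in>A. c a * \<phi> (v a))"
  by (simp add: sum scale)

lemma eq_sum_keys:
  "\<phi> p = (\<Sum>m\<in>Poly_Mapping.keys p. Poly_Mapping.lookup p m * \<phi> (Poly_Mapping.single m 1))"
proof -
  have "\<phi> p = \<phi> (\<Sum>m\<in>Poly_Mapping.keys p. const (Poly_Mapping.lookup p m) * Poly_Mapping.single m 1)"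
    by (subst mpoly_eq_sum_single[of p]) (simp add: mult_single)
  then show ?thesis by (simp add: combination)
qed

lemma times: "poly_functional (\<lambda>q. \<phi> (p * q))"
  by unfold_locales (simp add: distrib_left add, metis mult.left_commute scale)

end

text \<open>
  The new functional is not a combination of the earlier ones, so some point sees the difference;
  after correcting that point by the earlier dual points, it is seen by the new functional alone.
\<close>

lemma dual_family:
  fixes f :: "nat \<Rightarrow> 'k::field mpoly \<Rightarrow> 'k"
  assumes lin: "\<And>a. a < m \<Longrightarrow> poly_functional (f a)"
    and Q: "\<And>p q. p \<in> Q \<Longrightarrow> q \<in> Q \<Longrightarrow> p + q \<in> Q" "\<And>c p. p \<in> Q \<Longrightarrow> const c * p \<in> Q" "0 \<in> Q"
    and indep: "lin_indep_on Q m f"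
  shows "\<exists>q. (\<forall>b<m. q b \<in> Q) \<and> (\<forall>a<m. \<forall>b<m. f a (q b) = (if a = b then 1 else 0))"
  using lin indep
proof (induction m)
  case 0
  then show ?case by simp
next
  case (Suc m)
  have Qsum: "(\<Sum>a\<in>A. g a) \<in> Q" if "\<And>a. a \<in> A \<Longrightarrow> g a \<in> Q" for A :: "nat set" and g
    using that by (induction A rule: infinite_finite_induct) (auto intro: Q)
  obtain q where q: "\<And>b. b < m \<Longrightarrow> q b \<in> Q"
      "\<And>a b. a < m \<Longrightarrow> b < m \<Longrightarrow> f a (q b) = (if a = b then 1 else 0)"
    using Suc.IH Suc.prems lin_indep_on_butlast by (metis less_Suc_eq)
  have lin: "poly_functional (f a)" if "a \<le> m" for a
    using Suc.prems(1) that by simp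
  have "\<exists>x\<in>Q. f m x - (\<Sum>a<m. f m (q a) * f a x) \<noteq> 0"
  proof (rule ccontr)
    assume "\<not> ?thesis"
    then have "(\<Sum>a<Suc m. (if a = m then 1 else - f m (q a)) * f a x) = 0" if "x \<in> Q" for x
      using that by (simp add: sum_negf)
    from lin_indep_onD[OF Suc.prems(2) this, of m] show False by simp
  qed
  then obtain x where x: "x \<in> Q" and g: "f m x - (\<Sum>a<m. f m (q a) * f a x) \<noteq> 0" by blast
  define g where "g = f m x - (\<Sum>a<m. f m (q a) * f a x)"
  \<comment> \<open>make the new point invisible to the earlier functionals, then clear the last one\<close>
  define y where "y = const (1 / g) * (x + (\<Sum>a<m. const (- f a x) * q a))"
  define q' where "q' b = (if b < m then q b + const (- f m (q b)) * y else y)" for b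
  have yQ: "y \<in> Q"
    unfolding y_def using x q(1) by (intro Q(1) Q(2) Qsum) auto
  have fy: "f b y = (if b = m then 1 else 0)" if "b \<le> m" for b
  proof -
    interpret poly_functional "f b" by (rule lin[OF that])
    have eq: "f b y = (1 / g) * (f b x - (\<Sum>a<m. f a x * f b (q a)))"
      by (simp add: y_def scale add combination sum_negf)
    show ?thesis
    proof (cases "b = m")
      case True
      then show ?thesis using eq g by (simp add: g_def mult.commute)
    next
      case False
      then have "b < m" using that by simp
      then have "(\<Sum>a<m. f a x * f b (q a)) = (\<Sum>a<m. if a = b then f a x else 0)"
        by (intro sum.cong) (auto simp: q(2))
      then have "(\<Sum>a<m. f a x * f b (q a)) = f b x" using \<open>b < m\<close> by simp
      then show ?thesis using eq False by simp
    qed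
  qed
  have "f a (q' b) = (if a = b then 1 else 0)" if "a < Suc m" "b < Suc m" for a b
  proof -
    have "a \<le> m" using that by simp
    interpret poly_functional "f a" by (rule lin[OF \<open>a \<le> m\<close>])
    have "f a (q' b) = (if b < m then f a (q b) - f m (q b) * f a y else f a y)"
      by (simp add: q'_def add scale)
    then show ?thesis
      using that q(2)[of a b] fy[OF \<open>a \<le> m\<close>] by (auto simp: less_Suc_eq split: if_splits)
  qed
  moreover have "q' b \<in> Q" if "b < Suc m" for b
    using that q(1) yQ Q by (auto simp: q'_def)
  ultimately show ?case by blast
qed

section \<open>Polarization\<close>

text \<open>
  Expanding the power gives a polynomial in \<open>t\<close> that vanishes on an infinite field; its linear
  coefficient is \<open>Suc k\<close> times the claimed value.
\<close>

lemma (in poly_functional) power_polarization: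
  fixes l x :: "'k mpoly"
  assumes char: "of_nat (Suc k) \<noteq> (0::'k)" and inf: "infinite (UNIV :: 'k set)"
    and van: "\<And>t. \<phi> ((const t * x + l) ^ Suc k) = 0"
  shows "\<phi> (x * l ^ k) = 0"
proof -
  define P where "P = (\<Sum>i\<le>Suc k. Polynomial.monom (of_nat (Suc k choose i) * \<phi> (x ^ i * l ^ (Suc k - i))) i)"
  have pow: "(const t * x) ^ i = const (t ^ i) * x ^ i" for t and i :: nat
  proof -
    have "const t ^ i = const (t ^ i)"
      by (induction i) (simp_all add: mult_single)
    then show ?thesis by (simp add: power_mult_distrib)
  qed
  have "poly P t = \<phi> ((const t * x + l) ^ Suc k)" for t
  proof -
    have "(const t * x + l) ^ Suc k
        = (\<Sum>i\<le>Suc k. const (of_nat (Suc k choose i) * t ^ i) * (x ^ i * l ^ (Suc k - i)))"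
      unfolding binomial_ring pow
      by (intro sum.cong refl) (simp only: const_mult of_nat_single o_apply mult.assoc)
    then show ?thesis
      by (simp only: combination P_def poly_sum poly_monom) (intro sum.cong refl, simp add: mult_ac)
  qed
  then have "poly P t = 0" for t using van by simp
  then have "P = 0" using inf poly_roots_finite[of P] by auto
  then have "coeff P 1 = 0" by simp
  moreover have "coeff P 1 = of_nat (Suc k) * \<phi> (x * l ^ k)"
  proof -
    have "coeff P 1 = (\<Sum>i\<le>Suc k. if i = 1 then of_nat (Suc k choose i) * \<phi> (x ^ i * l ^ (Suc k - i)) else 0)"
      unfolding P_def coeff_sum by (intro sum.cong refl) simp
    also have "\<dots> = of_nat (Suc k choose 1) * \<phi> (x ^ 1 * l ^ (Suc k - 1))"
      by (subst sum.delta) auto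
    finally show ?thesis by simp
  qed
  ultimately show ?thesis using char by simp
qed

section \<open>Dual generators\<close>

text \<open>
  A functional supported in degree \<open>d\<close> is a Macaulay dual generator. The contraction of \<open>\<phi>\<close> by \<open>p\<close> is
  the functional \<open>img p\<close> below, and the forms with zero contraction generate the homogeneous ideal whose
  quotient is the graded Gorenstein algebra with dual generator \<open>\<phi>\<close>. Thus \<open>img\<close> embeds this algebra into a
  space of functions, where linear independence can be discussed without quotients.
\<close>

locale dual_generator = poly_functional \<phi>
  for \<phi> :: "'k::field_char_0 mpoly \<Rightarrow> 'k" +
  fixes n d :: nat
  assumes support: "\<phi> (Poly_Mapping.single m c) \<noteq> 0 \<Longrightarrow> mon_degree m = d \<and> Poly_Mapping.keys m \<subseteq> {..<n}"
begin

abbreviation forms :: "nat \<Rightarrow> 'k mpoly set" where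
  "forms \<equiv> poly_comp n"

abbreviation img :: "'k mpoly \<Rightarrow> 'k mpoly \<Rightarrow> 'k" where
  "img p \<equiv> \<lambda>q. \<phi> (p * q)"

lemma img_combination:
  "img (\<Sum>a\<in>A. const (c a) * v a) q = (\<Sum>a\<in>A. c a * img (v a) q)"
  by (simp add: sum_distrib_right mult.assoc combination)

lemma img_mult_combination:
  "img (k * (\<Sum>a\<in>A. const (c a) * v a)) q = (\<Sum>a\<in>A. c a * img (k * v a) q)"
  using img_combination[of c "\<lambda>a. k * v a" A q] by (simp add: sum_distrib_left mult.left_commute)

text \<open>
  The pairing between degrees \<open>j\<close> and \<open>d - j\<close> is perfect: all other monomials pair to zero
  with a form of degree \<open>j\<close> because \<open>\<phi>\<close> is supported in degree \<open>d\<close>.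
\<close>

lemma img_eq_0_of_monomials:
  assumes p: "p \<in> forms j"
    and mon: "\<And>m. mon_degree m + j = d \<Longrightarrow> Poly_Mapping.keys m \<subseteq> {..<n} \<Longrightarrow> img p (Poly_Mapping.single m 1) = 0"
  shows "img p q = 0"
proof -
  have "img p (Poly_Mapping.single m 1) = 0" for m
  proof (cases "mon_degree m + j = d \<and> Poly_Mapping.keys m \<subseteq> {..<n}")
    case True
    then show ?thesis using mon by blast
  next
    case False
    have "\<phi> (Poly_Mapping.single m 1 * Poly_Mapping.single m' 1) = 0" if "m' \<in> Poly_Mapping.keys p" for m'
      using False that p support[of "m + m'" 1]
      by (auto simp: mult_single mon_degree_add keys_add_nat mem_poly_comp_iff)
    then show ?thesis
      using poly_functional.eq_sum_keys[OF times[of "Poly_Mapping.single m 1"], of p]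
      by (simp add: mult.commute)
  qed
  then show ?thesis
    using poly_functional.eq_sum_keys[OF times[of p], of q] by simp
qed

lemma img_eq_0_of_forms:
  assumes "p \<in> forms j" "j + k = d" "\<And>q. q \<in> forms k \<Longrightarrow> img p q = 0"
  shows "img p q = 0"
proof (rule img_eq_0_of_monomials[OF assms(1)])
  fix m assume "mon_degree m + j = d" "Poly_Mapping.keys m \<subseteq> {..<n}"
  with assms(2) have "Poly_Mapping.single m 1 \<in> forms k" by (intro poly_comp_single) auto
  then show "img p (Poly_Mapping.single m 1) = 0" by (rule assms(3))
qed

lemma lin_indep_on_forms:
  assumes v: "\<And>a. a < m \<Longrightarrow> v a \<in> forms j" and "j + k = d"
    and indep: "lin_indep m (\<lambda>a. img (v a))"
  shows "lin_indep_on (forms k) m (\<lambda>a. img (v a))"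
proof (rule lin_indep_onI)
  fix c a assume *: "\<And>q. q \<in> forms k \<Longrightarrow> (\<Sum>a<m. c a * img (v a) q) = 0" and a: "a < m"
  have "(\<Sum>a<m. c a * img (v a) q) = 0" for q
  proof -
    have "(\<Sum>a<m. const (c a) * v a) \<in> forms j"
      using v by (intro poly_comp_sum poly_comp_const) auto
    from img_eq_0_of_forms[OF this \<open>j + k = d\<close>, of q] * show ?thesis
      by (simp add: img_combination)
  qed
  from lin_indep_onD[OF indep this a] show "c a = 0" by simp
qed

text \<open>
  In characteristic zero the powers of linear forms span the forms of their degree. The induction
  replaces the linear factors one at a time by variables.
\<close>

lemma img_eq_0_of_powers:
  assumes p: "p \<in> forms j" and "j + N = d"
    and van: "\<And>l q. l \<in> forms 1 \<Longrightarrow> img (l ^ N * p) q = 0"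
  shows "img p q = 0"
proof (rule img_eq_0_of_monomials[OF p])
  fix m assume m: "mon_degree m + j = d" "Poly_Mapping.keys m \<subseteq> {..<n}"
  have "img (l ^ (N - r) * p) (Poly_Mapping.single m 1 * q) = 0"
    if "r \<le> N" "mon_degree m = r" "Poly_Mapping.keys m \<subseteq> {..<n}" "l \<in> forms 1" for r m l q
    using that
  proof (induction r arbitrary: m l q)
    case 0
    then show ?case using van by (simp add: mon_degree_eq_0_iff)
  next
    case (Suc r)
    obtain i m' where i: "i < n" "m = Poly_Mapping.single i 1 + m'" "mon_degree m' = r"
        "Poly_Mapping.keys m' \<subseteq> {..<n}"
      using monomial_factor[OF Suc.prems(2,3)] by metis
    define x :: "'k mpoly" where "x = Poly_Mapping.single (Poly_Mapping.single i 1) 1"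
    have x: "x \<in> forms 1" unfolding x_def using i(1) by (intro poly_comp_single) auto
    interpret g: poly_functional "\<lambda>s. \<phi> (p * (Poly_Mapping.single m' 1 * q) * s)"
      by (rule times)
    have k: "N - r = Suc (N - Suc r)" using Suc.prems(1) by simp
    have "\<phi> (p * (Poly_Mapping.single m' 1 * q) * (const t * x + l) ^ Suc (N - Suc r)) = 0" for t
    proof -
      have "const t * x + l \<in> forms 1"
        using Suc.prems(4) x by (intro poly_comp_add poly_comp_const)
      from Suc.IH[OF _ i(3,4) this, of q] Suc.prems(1) show ?thesis
        unfolding k by (simp only: mult_ac)
    qed
    then have "\<phi> (p * (Poly_Mapping.single m' 1 * q) * (x * l ^ (N - Suc r))) = 0"
      by (intro g.power_polarization) (auto simp: infinite_UNIV_char_0 simp del: of_nat_Suc)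
    moreover have "Poly_Mapping.single m 1 = x * Poly_Mapping.single m' (1::'k)"
      unfolding x_def i(2) by (simp add: mult_single)
    ultimately show ?case by (simp add: mult_ac)
  qed
  from this[of N m 0 1] m \<open>j + N = d\<close> show "img p (Poly_Mapping.single m 1) = 0" by simp
qed

section \<open>Lifting kernel elements along a pencil\<close>

text \<open>
  If \<open>l * x\<close> missed \<open>l' * v m\<close>, then the image of \<open>l + t * l'\<close> would, for general \<open>t\<close>, contain
  perturbations of \<open>\<rho>\<close> independent images under \<open>l\<close> together with \<open>l' * v m\<close>, a multiple of the image of the
  alternating sum of the \<open>t ^ i * v i\<close>. This contradicts the maximality of the rank \<open>\<rho>\<close> of \<open>l\<close>.
\<close>

lemma kernel_lift_step:
  assumes l: "l \<in> forms 1" "l' \<in> forms 1"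
    and max: "\<And>k m c. k \<in> forms 1 \<Longrightarrow> (\<And>a. a < m \<Longrightarrow> c a \<in> forms j) \<Longrightarrow>
      lin_indep m (\<lambda>a. img (k * c a)) \<Longrightarrow> m \<le> \<rho>"
    and c: "\<And>a. a < \<rho> \<Longrightarrow> c a \<in> forms j" "lin_indep \<rho> (\<lambda>a. img (l * c a))"
    and v: "\<And>i. i \<le> m \<Longrightarrow> v i \<in> forms j" "\<And>q. img (l * v 0) q = 0"
      "\<And>i q. i < m \<Longrightarrow> img (l * v (Suc i)) q = img (l' * v i) q"
  shows "\<exists>x\<in>forms j. \<forall>q. img (l * x) q = img (l' * v m) q"
proof (rule ccontr)
  assume contr: "\<not> ?thesis"
  define f where "f a q = (if a < \<rho> then [:img (l * c a) q, img (l' * c a) q:] else [:img (l' * v m) q:])" for a q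
  have "lin_indep (Suc \<rho>) (\<lambda>a q. poly (f a q) 0)"
  proof (rule lin_indep_on_Suc)
    show "lin_indep \<rho> (\<lambda>a q. poly (f a q) 0)"
      using c(2) by (simp add: f_def cong: lin_indep_on_cong)
    fix e
    have "\<exists>q. img (l * (\<Sum>a<\<rho>. const (e a) * c a)) q \<noteq> img (l' * v m) q"
      using contr c(1) by (auto intro!: poly_comp_sum poly_comp_const)
    then obtain q where "img (l * (\<Sum>a<\<rho>. const (e a) * c a)) q \<noteq> img (l' * v m) q" by blast
    then show "\<exists>q\<in>UNIV. poly (f \<rho> q) 0 \<noteq> (\<Sum>a<\<rho>. e a * poly (f a q) 0)"
      by (intro bexI[of _ q]) (auto simp: f_def img_mult_combination)
  qed
  from lin_indep_perturb[OF this]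
  have "finite (insert 0 {t. \<not> lin_indep (Suc \<rho>) (\<lambda>a q. poly (f a q) t)})" by simp
  then obtain t where t: "t \<noteq> 0" "lin_indep (Suc \<rho>) (\<lambda>a q. poly (f a q) t)"
    using ex_new_if_finite[OF infinite_UNIV_char_0] by blast
  define k where "k = l + const t * l'"
  define w where "w = (\<Sum>i\<in>{..m}. const ((- t) ^ i) * v i)"
  define c' where "c' a = (if a < \<rho> then c a else const (1 / (t * (- t) ^ m)) * w)" for a
  have k_img: "img (k * x) q = img (l * x) q + t * img (l' * x) q" for x q
    by (simp add: k_def distrib_right add mult.assoc scale)
  \<comment> \<open>the generating polynomial of the chain telescopes under the perturbed linear form\<close>
  have w: "img (k * w) q = t * (- t) ^ m * img (l' * v m) q" for q
  proof -
    let ?A = "\<lambda>i. (- t) ^ i * img (l * v i) q"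
    have "img (k * w) q = (\<Sum>i\<le>m. (- t) ^ i * img (k * v i) q)"
      unfolding w_def by (rule img_mult_combination)
    also have "\<dots> = (\<Sum>i<m. ?A i - ?A (Suc i)) + ((- t) ^ m * img (k * v m) q)"
    proof -
      have "(- t) ^ i * img (k * v i) q = ?A i - ?A (Suc i)" if "i < m" for i
        unfolding k_img v(3)[OF that] by (simp add: algebra_simps)
      then show ?thesis by (simp add: lessThan_Suc_atMost[symmetric])
    qed
    also have "\<dots> = t * (- t) ^ m * img (l' * v m) q"
      unfolding sum_lessThan_telescope'[of ?A] k_img using v(2)[of q] by (simp add: distrib_left)
    finally show ?thesis .
  qed
  have "img (k * c' a) q = poly (f a q) t" for a q
  proof (cases "a < \<rho>")
    case True
    then show ?thesis by (simp add: c'_def f_def k_img)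
  next
    case False
    then have "img (k * c' a) q = 1 / (t * (- t) ^ m) * img (k * w) q"
      using img_mult_combination[of k "\<lambda>_. 1 / (t * (- t) ^ m)" "\<lambda>_. w" "{0::nat}" q]
      by (simp add: c'_def)
    then show ?thesis using False t(1) by (simp add: w f_def)
  qed
  then have "lin_indep (Suc \<rho>) (\<lambda>a. img (k * c' a))" using t(2) by simp
  moreover have "k \<in> forms 1" unfolding k_def using l by (intro poly_comp_add poly_comp_const)
  moreover have "c' a \<in> forms j" for a
    unfolding c'_def w_def using c(1) v(1) by (auto intro!: poly_comp_sum poly_comp_const)
  ultimately have "Suc \<rho> \<le> \<rho>" by (intro max[of k _ c'])
  then show False by simp
qed

text \<open>
  For a linear form of maximal rank, every kernel element is the constant term of a formal power
  series in the kernel of the pencil \<open>l + t * l'\<close>; up to sign, the \<open>v i\<close> are its coefficients.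
\<close>

lemma kernel_lift:
  assumes l: "l \<in> forms 1" "l' \<in> forms 1"
    and max: "\<And>k m c. k \<in> forms 1 \<Longrightarrow> (\<And>a. a < m \<Longrightarrow> c a \<in> forms j) \<Longrightarrow>
      lin_indep m (\<lambda>a. img (k * c a)) \<Longrightarrow> m \<le> \<rho>"
    and c: "\<And>a. a < \<rho> \<Longrightarrow> c a \<in> forms j" "lin_indep \<rho> (\<lambda>a. img (l * c a))"
    and p: "p \<in> forms j" "\<And>q. img (l * p) q = 0"
  shows "\<exists>v. v 0 = p \<and> (\<forall>i. v i \<in> forms j) \<and> (\<forall>i q. img (l * v (Suc i)) q = img (l' * v i) q)"
proof -
  define v where "v = rec_nat p (\<lambda>_ x. SOME y. y \<in> forms j \<and> (\<forall>q. img (l * y) q = img (l' * x) q))"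
  have v0: "v 0 = p" by (simp add: v_def)
  have vS: "v (Suc i) = (SOME y. y \<in> forms j \<and> (\<forall>q. img (l * y) q = img (l' * v i) q))" for i
    by (simp add: v_def)
  have "(\<forall>i\<le>m. v i \<in> forms j) \<and> (\<forall>i<m. \<forall>q. img (l * v (Suc i)) q = img (l' * v i) q)" for m
  proof (induction m)
    case 0
    then show ?case using p v0 by simp
  next
    case (Suc m)
    have "\<exists>x\<in>forms j. \<forall>q. img (l * x) q = img (l' * v m) q"
      by (rule kernel_lift_step[OF l max c]) (use Suc p v0 in auto)
    then have "\<exists>x. x \<in> forms j \<and> (\<forall>q. img (l * x) q = img (l' * v m) q)" by blast
    from someI_ex[OF this, folded vS] Suc show ?case
      by (auto simp: less_Suc_eq le_Suc_eq)
  qed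
  then show ?thesis using v0 by (intro exI[of _ v]) blast
qed

text \<open>
  Commutativity moves indices from one factor to the other, \<open>l * v (Suc a) * v b\<close> being congruent to
  \<open>l' * v a * v b\<close> and hence to \<open>l * v a * v (Suc b)\<close>, until the kernel element \<open>v 0\<close> appears.
\<close>

lemma chain_isotropic:
  assumes v0: "\<And>q. img (l * v 0) q = 0"
    and step: "\<And>i q. img (l * v (Suc i)) q = img (l' * v i) q"
  shows "img (l * v a * v b) q = 0"
proof (induction a arbitrary: b)
  case 0
  then show ?case using v0[of "v b * q"] by (simp add: mult_ac)
next
  case (Suc a)
  have "img (l * v (Suc a) * v b) q = img (l' * v a) (v b * q)"
    using step[of a "v b * q"] by (simp add: mult.assoc)
  also have "\<dots> = img (l' * v b) (v a * q)" by (simp add: mult_ac)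
  also have "\<dots> = img (l * v (Suc b)) (v a * q)" using step[of b "v a * q"] by simp
  also have "\<dots> = img (l * v a * v (Suc b)) q" by (simp add: mult_ac)
  finally show ?case using Suc.IH by simp
qed

text \<open>
  Modulo the annihilator of \<open>\<phi>\<close>, the product \<open>l ^ s * l' * v i\<close> vanishes for \<open>i < s\<close> and equals
  \<open>l' ^ Suc s * v 0\<close> for \<open>i = s\<close>. Hence a relation between the \<open>l' * v i\<close> with last index \<open>s\<close> forces
  \<open>l' ^ Suc s * v 0\<close> to vanish: a chain that stays in a small space starts at an element killed by a small
  power of \<open>l'\<close>.
\<close>

lemma chain_lin_indep:
  assumes v0: "\<And>q. img (l * v 0) q = 0"
    and step: "\<And>i q. img (l * v (Suc i)) q = img (l' * v i) q"
    and pow: "img (l' ^ N * v 0) q0 \<noteq> 0"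
  shows "lin_indep N (\<lambda>i. img (l * v (Suc i)))"
    and "lin_indep (Suc N) (\<lambda>i. img (v i))"
proof -
  have diag: "img (l ^ i * l' * v i) q = img (l' ^ Suc i * v 0) q" for i q
  proof (induction i arbitrary: q)
    case (Suc i)
    have "img (l ^ Suc i * l' * v (Suc i)) q = img (l * v (Suc i)) (l ^ i * l' * q)"
      by (simp add: mult_ac)
    also have "\<dots> = img (l' * v i) (l ^ i * l' * q)" by (rule step)
    also have "\<dots> = img (l ^ i * l' * v i) (l' * q)" by (simp add: mult_ac)
    also have "\<dots> = img (l' ^ Suc (Suc i) * v 0) q" by (simp only: Suc.IH) (simp add: mult_ac)
    finally show ?case .
  qed (simp add: mult_ac)
  have below: "img (l ^ s * l' * v i) q = 0" if "i < s" for i s q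
  proof -
    have "l ^ s = l ^ i * l * l ^ (s - Suc i)"
      using that by (metis Suc_leI le_add_diff_inverse power_Suc2 power_add)
    then have "img (l ^ s * l' * v i) q = img (l ^ i * l' * v i) (l * l ^ (s - Suc i) * q)"
      by (simp add: mult_ac)
    also have "\<dots> = img (l * v 0) (l' ^ Suc i * l ^ (s - Suc i) * q)"
      unfolding diag by (simp add: mult_ac)
    finally show ?thesis using v0 by simp
  qed
  show indep: "lin_indep N (\<lambda>i. img (l * v (Suc i)))"
  proof (rule lin_indep_onI, rule ccontr)
    fix c a assume *: "\<And>q. q \<in> UNIV \<Longrightarrow> (\<Sum>a<N. c a * img (l * v (Suc a)) q) = 0"
      and a: "a < N" "c a \<noteq> 0"
    define s where "s = Max {a. a < N \<and> c a \<noteq> 0}"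
    have fin: "finite {a. a < N \<and> c a \<noteq> 0}" by simp
    have s: "s < N" "c s \<noteq> 0"
      using Max_in[OF fin] a unfolding s_def by blast+
    have above: "c i = 0" if "s < i" "i < N" for i
      using Max_ge[OF fin, of i] that unfolding s_def by fastforce
    \<comment> \<open>multiplying by this power of \<open>l\<close> isolates the last coefficient\<close>
    define r where "r = l' ^ (N - Suc s) * q0"
    have summand: "c i * img (l * v (Suc i)) (l ^ s * r) = (if i = s then c s * img (l' ^ N * v 0) q0 else 0)"
      if "i < N" for i
    proof -
      have eq: "img (l * v (Suc i)) (l ^ s * r) = img (l ^ s * l' * v i) r"
        unfolding step by (simp add: mult_ac)
      consider "i < s" | "i = s" | "s < i" by linarith
      then show ?thesis
      proof cases
        case 1
        then show ?thesis using below[OF 1] by (simp add: eq)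
      next
        case 2
        have "l' ^ N = l' ^ (Suc s + (N - Suc s))" using s(1) by simp
        also have "\<dots> = l' ^ Suc s * l' ^ (N - Suc s)" by (rule power_add)
        finally have N: "l' ^ N = l' ^ Suc s * l' ^ (N - Suc s)" .
        have "img (l' ^ Suc s * v 0) r = img (l' ^ N * v 0) q0"
          unfolding N r_def by (simp only: mult_ac)
        then have "img (l * v (Suc i)) (l ^ s * r) = img (l' ^ N * v 0) q0"
          unfolding eq unfolding 2 diag .
        then show ?thesis using 2 by simp
      next
        case 3
        then show ?thesis using above[OF 3 that] by simp
      qed
    qed
    have "(\<Sum>i<N. c i * img (l * v (Suc i)) (l ^ s * r)) = c s * img (l' ^ N * v 0) q0"
    proof -
      have "(\<Sum>i<N. c i * img (l * v (Suc i)) (l ^ s * r))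
          = (\<Sum>i<N. if i = s then c s * img (l' ^ N * v 0) q0 else 0)"
        by (intro sum.cong refl summand) simp
      also have "\<dots> = c s * img (l' ^ N * v 0) q0"
        using s(1) by (subst sum.delta) auto
      finally show ?thesis .
    qed
    with *[of "l ^ s * r"] have "c s * img (l' ^ N * v 0) q0 = 0" by simp
    with s(2) pow show False by simp
  qed
  show "lin_indep (Suc N) (\<lambda>i. img (v i))"
  proof (rule lin_indep_onI)
    fix c a assume *: "\<And>q. q \<in> UNIV \<Longrightarrow> (\<Sum>i<Suc N. c i * img (v i) q) = 0" and a: "a < Suc N"
    have "(\<Sum>i<N. c (Suc i) * img (l * v (Suc i)) q) = 0" for q
      using *[of "l * q"] v0[of q] by (simp add: sum.lessThan_Suc_shift mult_ac del: sum.lessThan_Suc)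
    from lin_indep_onD[OF indep this] have c: "c (Suc i) = 0" if "i < N" for i using that by blast
    have "c 0 * img (v 0) (l' ^ N * q0) = 0"
      using *[of "l' ^ N * q0"] c by (simp add: sum.lessThan_Suc_shift del: sum.lessThan_Suc)
    with pow have "c 0 = 0" by (simp add: mult_ac)
    with c a show "c a = 0" by (cases a) auto
  qed
qed

end

section \<open>Injective and surjective multiplication maps\<close>

context dual_generator
begin

text \<open>
  The rank in question is that of the pairing between degrees \<open>i\<close> and \<open>d - i\<close>, that is, the value at \<open>i\<close> of the
  Hilbert function of the algebra with dual generator \<open>\<phi>\<close>.
\<close>

definition rank_le :: "nat \<Rightarrow> nat \<Rightarrow> bool" where
  "rank_le i B \<longleftrightarrow> (\<forall>m v. (\<forall>a<m. v a \<in> forms i) \<longrightarrow> lin_indep m (\<lambda>a. img (v a)) \<longrightarrow> m \<le> B)"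

lemma rank_leD:
  "rank_le i B \<Longrightarrow> (\<And>a. a < m \<Longrightarrow> v a \<in> forms i) \<Longrightarrow> lin_indep m (\<lambda>a. img (v a)) \<Longrightarrow> m \<le> B"
  unfolding rank_le_def by blast

definition injective_at :: "'k mpoly \<Rightarrow> nat \<Rightarrow> bool" where
  "injective_at l i \<longleftrightarrow> (\<forall>p\<in>forms i. (\<forall>q. img (l * p) q = 0) \<longrightarrow> (\<forall>q. img p q = 0))"

definition surjective_at :: "'k mpoly \<Rightarrow> nat \<Rightarrow> bool" where
  "surjective_at l i \<longleftrightarrow> (\<forall>r\<in>forms (Suc i). \<exists>p\<in>forms i. \<forall>q. img r q = img (l * p) q)"

definition isotropic_chain :: "'k mpoly \<Rightarrow> nat \<Rightarrow> nat \<Rightarrow> (nat \<Rightarrow> 'k mpoly) \<Rightarrow> bool" where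
  "isotropic_chain l j N v \<longleftrightarrow>
     (\<forall>i. v i \<in> forms j) \<and> (\<forall>q. img (l * v 0) q = 0) \<and> (\<exists>q. img (v 0) q \<noteq> 0) \<and>
     (\<forall>a b q. img (l * v a * v b) q = 0) \<and>
     lin_indep N (\<lambda>i. img (l * v (Suc i))) \<and> lin_indep (Suc N) (\<lambda>i. img (v i))"

lemma mult_form: "l \<in> forms 1 \<Longrightarrow> p \<in> forms i \<Longrightarrow> l * p \<in> forms (Suc i)"
  using poly_comp_mult[of l n 1 p i] by simp

text \<open>
  The form \<open>l\<close> is chosen of maximal rank; the bound makes that maximum exist. If \<open>l\<close> kills
  some nonzero \<open>p\<close>, then some power \<open>l' ^ N\<close> does not kill \<open>p\<close>, as these powers span the forms of
  complementary degree, and the chain starting at \<open>p\<close> along this \<open>l'\<close> is long.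
\<close>

lemma injective_or_isotropic_chain:
  assumes bound: "rank_le (Suc j) B" and N: "j + N = d"
  shows "\<exists>l\<in>forms 1. injective_at l j \<or> (\<exists>v. isotropic_chain l j N v)"
proof -
  define P where "P \<rho> \<longleftrightarrow> (\<exists>l\<in>forms 1. \<exists>c. (\<forall>a<\<rho>. c a \<in> forms j) \<and> lin_indep \<rho> (\<lambda>a. img (l * c a)))" for \<rho>
  have "P 0" unfolding P_def by (intro bexI[of _ 0]) (auto simp: lin_indep_on_def)
  moreover have le: "m \<le> B" if "P m" for m
  proof -
    from that obtain l c where "l \<in> forms 1" "\<forall>a<m. c a \<in> forms j" "lin_indep m (\<lambda>a. img (l * c a))"
      unfolding P_def by blast
    then show ?thesis
      using mult_form by (intro rank_leD[OF bound, of m "\<lambda>a. l * c a"]) simp_all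
  qed
  ultimately have "P (Greatest P)" by (rule GreatestI_nat)
  then obtain l c where l: "l \<in> forms 1"
      and c: "\<And>a. a < Greatest P \<Longrightarrow> c a \<in> forms j" "lin_indep (Greatest P) (\<lambda>a. img (l * c a))"
    unfolding P_def by blast
  have max: "m \<le> Greatest P"
    if "k \<in> forms 1" "\<And>a. a < m \<Longrightarrow> c a \<in> forms j" "lin_indep m (\<lambda>a. img (k * c a))" for k m c
    by (rule Greatest_le_nat[of P, OF _ le]) (use that in \<open>auto simp: P_def\<close>)
  show ?thesis
  proof (cases "injective_at l j")
    case True
    then show ?thesis using l by blast
  next
    case False
    then obtain p q where p: "p \<in> forms j" "\<And>q. img (l * p) q = 0" "img p q \<noteq> 0"
      unfolding injective_at_def by blast
    obtain l' q0 where l': "l' \<in> forms 1" "img (l' ^ N * p) q0 \<noteq> 0"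
      using img_eq_0_of_powers[OF p(1) N] p(3) by blast
    have "\<exists>v. v 0 = p \<and> (\<forall>i. v i \<in> forms j) \<and> (\<forall>i q. img (l * v (Suc i)) q = img (l' * v i) q)"
      by (rule kernel_lift[where \<rho> = "Greatest P" and c = c]) (fact l l'(1) max c p(1,2))+
    then obtain v where v: "v 0 = p" "\<And>i. v i \<in> forms j" "\<And>i q. img (l * v (Suc i)) q = img (l' * v i) q"
      by blast
    have v0: "\<And>q. img (l * v 0) q = 0" using v(1) p(2) by simp
    have "isotropic_chain l j N v"
      unfolding isotropic_chain_def
    proof (intro conjI allI)
      show "img (l * v a * v b) q = 0" for a b q
        by (rule chain_isotropic[OF v0 v(3)])
      show "lin_indep N (\<lambda>i. img (l * v (Suc i)))" "lin_indep (Suc N) (\<lambda>i. img (v i))"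
        using chain_lin_indep[OF v0 v(3), of N q0] l'(2) v(1) by auto
    qed (use v p in auto)
    then show ?thesis using l by blast
  qed
qed

text \<open>
  Dual forms of the \<open>v a\<close> live in the same degree as the \<open>u a\<close> and are independent from them, because
  the \<open>v a\<close> separate them.
\<close>

lemma isotropic_rank_bound:
  assumes v: "\<And>a. a < m \<Longrightarrow> v a \<in> forms j" "lin_indep m (\<lambda>a. img (v a))"
    and jk: "j + k = d" and bound: "rank_le k B"
    and u: "\<And>a. a < w \<Longrightarrow> u a \<in> forms k" "lin_indep w (\<lambda>a. img (u a))"
    and orth: "\<And>a b. a < w \<Longrightarrow> b < m \<Longrightarrow> img (u a) (v b) = 0"
  shows "m + w \<le> B"
proof -
  obtain x where x: "\<And>b. b < m \<Longrightarrow> x b \<in> forms k"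
      "\<And>a b. a < m \<Longrightarrow> b < m \<Longrightarrow> img (v a) (x b) = (if a = b then 1 else 0)"
    using dual_family[of m "\<lambda>a. img (v a)" "forms k", OF times poly_comp_add poly_comp_const poly_comp_0
        lin_indep_on_forms[OF v(1) jk v(2)]] by auto
  have "lin_indep (m + w) (\<lambda>a. if a < m then img (x a) else img (u (a - m)))"
    using u(2) by (intro lin_indep_dual_append[where y = v]) (auto simp: x(2) orth mult.commute[of "x _"])
  moreover have "(if a < m then img (x a) else img (u (a - m))) = img (if a < m then x a else u (a - m))" for a
    by simp
  ultimately have "lin_indep (m + w) (\<lambda>a. img (if a < m then x a else u (a - m)))"
    by simp
  then show ?thesis
    using x(1) u(1) by (intro rank_leD[OF bound]) auto
qed

text \<open>
  Here \<open>l * v\<close> already has the degree complementary to that of \<open>v\<close>. A chain would yield \<open>j + 2\<close> elements \<open>v\<close>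
  orthogonal to \<open>j + 1\<close> elements \<open>l * v\<close>, that is, rank at least \<open>2 * j + 3\<close>.
\<close>

lemma injective_form_odd:
  assumes d: "d = Suc (2 * j)" and bound: "rank_le (Suc j) (2 * j + 2)"
  shows "\<exists>l\<in>forms 1. injective_at l j"
proof (rule ccontr)
  assume contr: "\<not> ?thesis"
  have jk: "j + Suc j = d" using d by simp
  obtain l v where l: "l \<in> forms 1" and v: "isotropic_chain l j (Suc j) v"
    using injective_or_isotropic_chain[OF bound jk] contr by blast
  have "Suc (Suc j) + Suc j \<le> 2 * j + 2"
  proof (rule isotropic_rank_bound[OF _ _ jk bound, where v = v and u = "\<lambda>i. l * v (Suc i)"])
    show "img (l * v (Suc a)) (v b) = 0" for a b
      using v unfolding isotropic_chain_def by (metis mult.right_neutral)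
  qed (use v l in \<open>auto simp: isotropic_chain_def intro: mult_form\<close>)
  then show False by simp
qed

text \<open>
  The contraction of \<open>\<phi>\<close> by \<open>l\<close> is the dual generator of the Gorenstein algebra \<open>A / (0 : l)\<close>, where \<open>A\<close> is the
  algebra of \<open>\<phi>\<close>.
\<close>

lemma times_dual_generator:
  assumes "l \<in> forms i"
  shows "dual_generator (\<lambda>p. \<phi> (l * p)) n (d - i)"
proof (intro dual_generator.intro dual_generator_axioms.intro times)
  fix m and c :: 'k assume nz: "\<phi> (l * Poly_Mapping.single m c) \<noteq> 0"
  then have "\<phi> (Poly_Mapping.single m c * l) \<noteq> 0" by (simp add: mult.commute)
  then obtain m' where m': "m' \<in> Poly_Mapping.keys l"
      "\<phi> (Poly_Mapping.single m c * Poly_Mapping.single m' 1) \<noteq> 0"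
    using poly_functional.eq_sum_keys[OF times, of "Poly_Mapping.single m c" l]
    by (metis (no_types, lifting) mult_zero_right sum.neutral)
  then have "mon_degree (m + m') = d \<and> Poly_Mapping.keys (m + m') \<subseteq> {..<n}"
    using support[of "m + m'" c] by (simp add: mult_single)
  then show "mon_degree m = d - i \<and> Poly_Mapping.keys m \<subseteq> {..<n}"
    using m'(1) assms by (auto simp: mem_poly_comp_iff mon_degree_add keys_add_nat)
qed

text \<open>
  Now \<open>l * v\<close> is one degree short of the complementary degree. A second linear form \<open>x\<close> bridges the
  gap without loss of dimension: it comes from the odd case for the contraction of \<open>\<phi>\<close> by \<open>l\<close>, whose
  rank in the relevant degree is strictly smaller because \<open>l\<close> has a kernel.
\<close>

lemma injective_form_even:
  assumes d: "d = 2 * j + 2" and bound': "rank_le (Suc j) B" and bound: "rank_le (j + 2) (2 * j + 3)"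
  shows "\<exists>l\<in>forms 1. injective_at l j"
proof (rule ccontr)
  assume contr: "\<not> ?thesis"
  have jk: "j + (j + 2) = d" using d by simp
  obtain l v where l: "l \<in> forms 1" and v: "isotropic_chain l j (j + 2) v"
    using injective_or_isotropic_chain[OF bound' jk] contr by blast
  interpret g: dual_generator "\<lambda>p. \<phi> (l * p)" n "Suc (2 * j)"
    using times_dual_generator[OF l] d by simp
  have v0: "v 0 \<in> forms j" "\<And>q. img (l * v 0) q = 0"
    using v by (auto simp: isotropic_chain_def)
  have "\<exists>r\<in>forms (j + 2). img (v 0) r \<noteq> 0"
    using v img_eq_0_of_forms[OF v0(1) jk] unfolding isotropic_chain_def by blast
  then obtain r where r: "r \<in> forms (j + 2)" "img (v 0) r \<noteq> 0" by blast
  have "g.rank_le (Suc j) (2 * j + 2)"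
    unfolding g.rank_le_def
  proof (intro allI impI)
    fix m w assume w: "\<forall>a<m. w a \<in> forms (Suc j)" and indep: "lin_indep m (\<lambda>a. g.img (w a))"
    \<comment> \<open>\<open>r\<close> is independent of the multiples of \<open>l\<close>, because \<open>v 0\<close> is orthogonal to the latter only\<close>
    define u where "u a = (if a < m then l * w a else r)" for a
    have "lin_indep (Suc m) (\<lambda>a. img (u a))"
    proof (rule lin_indep_on_Suc)
      show "lin_indep m (\<lambda>a. img (u a))"
        using indep by (simp add: u_def mult.assoc cong: lin_indep_on_cong)
      fix c
      have "(\<Sum>a<m. c a * img (u a) (v 0)) = 0"
      proof (intro sum.neutral ballI)
        fix a assume "a \<in> {..<m}"
        then show "c a * img (u a) (v 0) = 0"
          using v0(2)[of "w a"] by (simp add: u_def mult_ac)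
      qed
      moreover have "img (u m) (v 0) \<noteq> 0" using r(2) by (simp add: u_def mult.commute)
      ultimately show "\<exists>q\<in>UNIV. img (u m) q \<noteq> (\<Sum>a<m. c a * img (u a) q)"
        by (intro bexI[of _ "v 0"]) auto
    qed
    moreover have "u a \<in> forms (j + 2)" if "a < Suc m" for a
      using w r(1) mult_form[OF l, of "w a" "Suc j"] that by (auto simp: u_def less_Suc_eq)
    ultimately have "Suc m \<le> 2 * j + 3" by (intro rank_leD[OF bound, of _ u])
    then show "m \<le> 2 * j + 2" by simp
  qed
  then obtain x where x: "x \<in> forms 1" "g.injective_at x j"
    using g.injective_form_odd[OF refl] by blast
  let ?u = "\<lambda>i. x * (l * v (Suc i))"
  have indep: "lin_indep (j + 2) (\<lambda>a. img (?u a))"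
  proof (rule lin_indep_onI)
    fix c a assume *: "\<And>q. q \<in> UNIV \<Longrightarrow> (\<Sum>a<j + 2. c a * img (?u a) q) = 0" and a: "a < j + 2"
    define p where "p = (\<Sum>a<j + 2. const (c a) * v (Suc a))"
    have "p \<in> forms j"
      using v unfolding p_def isotropic_chain_def by (intro poly_comp_sum poly_comp_const) auto
    moreover have "g.img (x * p) q = 0" for q
    proof -
      have "g.img (x * p) q = img (x * l * p) q" by (simp add: mult_ac)
      also have "\<dots> = (\<Sum>a<j + 2. c a * img (?u a) q)"
        unfolding p_def img_mult_combination by (simp add: mult.assoc)
      finally show ?thesis using *[of q] by simp
    qed
    ultimately have "g.img p q = 0" for q using x(2) unfolding g.injective_at_def by blast
    then have "img (l * p) q = 0" for q by (simp add: mult.assoc)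
    then have "(\<Sum>a<j + 2. c a * img (l * v (Suc a)) q) = 0" for q
      unfolding p_def img_mult_combination .
    with v a show "c a = 0" unfolding isotropic_chain_def by (blast intro: lin_indep_onD)
  qed
  have "Suc (j + 2) + (j + 2) \<le> 2 * j + 3"
  proof (rule isotropic_rank_bound[OF _ _ jk bound _ indep, where v = v])
    show "img (?u a) (v b) = 0" for a b
    proof -
      have "img (l * v (Suc a) * v b) x = 0" using v unfolding isotropic_chain_def by blast
      then show ?thesis by (simp add: mult_ac)
    qed
    show "?u a \<in> forms (j + 2)" for a
      using mult_form[OF x(1) mult_form[OF l, of "v (Suc a)" j]] v by (simp add: isotropic_chain_def)
  qed (use v in \<open>auto simp: isotropic_chain_def\<close>)
  then show False by simp
qed

text \<open>
  If \<open>l\<close> kills \<open>p\<close>, it kills all multiples of \<open>p\<close> by variables; these vanish by injectivity, so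
  \<open>p\<close> pairs to zero with every monomial of positive degree.
\<close>

lemma injective_at_descend:
  assumes l: "l \<in> forms 1" and inj: "injective_at l (Suc i)" and "i < d"
  shows "injective_at l i"
  unfolding injective_at_def
proof (intro ballI impI allI)
  fix p q assume p: "p \<in> forms i" "\<forall>q. img (l * p) q = 0"
  show "img p q = 0"
  proof (rule img_eq_0_of_monomials[OF p(1)])
    fix m assume m: "mon_degree m + i = d" "Poly_Mapping.keys m \<subseteq> {..<n}"
    then have "mon_degree m = Suc (d - Suc i)" using \<open>i < d\<close> by simp
    from monomial_factor[OF this m(2)] obtain a m' where a: "a < n" "m = Poly_Mapping.single a 1 + m'"
      by metis
    define x :: "'k mpoly" where "x = Poly_Mapping.single (Poly_Mapping.single a 1) 1"
    have x: "x \<in> forms 1" unfolding x_def using a(1) by (intro poly_comp_single) auto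
    have "img (l * (x * p)) q = 0" for q
      using p(2)[rule_format, of "x * q"] by (simp add: mult_ac)
    then have "img (x * p) (Poly_Mapping.single m' 1) = 0"
      using inj mult_form[OF x p(1)] unfolding injective_at_def by blast
    moreover have "Poly_Mapping.single m 1 = x * Poly_Mapping.single m' (1::'k)"
      unfolding x_def a(2) by (simp add: mult_single)
    ultimately show "img p (Poly_Mapping.single m 1) = 0" by (simp add: mult_ac)
  qed
qed

text \<open>
  Multiplication by \<open>l\<close> in complementary degrees is adjoint. A form \<open>r\<close> outside the image is separated
  from the image by a form of complementary degree, which then lies in the kernel of the adjoint map.
\<close>

lemma surjective_at_of_injective_at:
  assumes l: "l \<in> forms 1" and inj: "injective_at l k" and ik: "Suc i + k = d"
    and bound: "rank_le (Suc i) B"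
  shows "surjective_at l i"
  unfolding surjective_at_def
proof (intro ballI, rule ccontr)
  fix r assume r: "r \<in> forms (Suc i)" and contr: "\<not> (\<exists>p\<in>forms i. \<forall>q. img r q = img (l * p) q)"
  define P where "P m \<longleftrightarrow> (\<exists>c. (\<forall>a<m. c a \<in> forms i) \<and> lin_indep m (\<lambda>a. img (l * c a)))" for m
  have "P 0" unfolding P_def by (auto simp: lin_indep_on_def)
  moreover have le: "m \<le> B" if "P m" for m
  proof -
    from that obtain c where "\<forall>a<m. c a \<in> forms i" "lin_indep m (\<lambda>a. img (l * c a))"
      unfolding P_def by blast
    then show ?thesis
      using mult_form[OF l] by (intro rank_leD[OF bound, of m "\<lambda>a. l * c a"]) simp_all
  qed
  ultimately have "P (Greatest P)" by (rule GreatestI_nat)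
  define m where "m = Greatest P"
  obtain c where c: "\<And>a. a < m \<Longrightarrow> c a \<in> forms i" "lin_indep m (\<lambda>a. img (l * c a))"
    using \<open>P (Greatest P)\<close> unfolding P_def m_def by blast
  have spanning: "\<exists>e. \<forall>q. img (l * p) q = (\<Sum>a<m. e a * img (l * c a) q)" if p: "p \<in> forms i" for p
  proof (rule ccontr)
    assume no: "\<not> ?thesis"
    have "lin_indep (Suc m) (\<lambda>a. img (l * (c(m := p)) a))"
    proof (rule lin_indep_on_Suc)
      show "lin_indep m (\<lambda>a. img (l * (c(m := p)) a))" using c(2) by (simp cong: lin_indep_on_cong)
    qed (use no in auto)
    then have "P (Suc m)" unfolding P_def using c(1) p by (intro exI[of _ "c(m := p)"]) auto
    from Greatest_le_nat[of P, OF this le] show False by (simp add: m_def)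
  qed
  define w where "w a = (if a < m then l * c a else r)" for a
  have indep: "lin_indep (Suc m) (\<lambda>a. img (w a))"
  proof (rule lin_indep_on_Suc)
    show "lin_indep m (\<lambda>a. img (w a))" using c(2) by (simp add: w_def cong: lin_indep_on_cong)
    fix e
    have "(\<Sum>a<m. const (e a) * c a) \<in> forms i"
      using c(1) by (intro poly_comp_sum poly_comp_const) auto
    then obtain q where "img r q \<noteq> img (l * (\<Sum>a<m. const (e a) * c a)) q" using contr by blast
    then show "\<exists>q\<in>UNIV. img (w m) q \<noteq> (\<Sum>a<m. e a * img (w a) q)"
      by (intro bexI[of _ q]) (auto simp: w_def img_mult_combination)
  qed
  have w: "w a \<in> forms (Suc i)" for a using c(1) r mult_form[OF l] by (auto simp: w_def)
  obtain x where x: "\<And>b. b < Suc m \<Longrightarrow> x b \<in> forms k"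
      "\<And>a b. a < Suc m \<Longrightarrow> b < Suc m \<Longrightarrow> img (w a) (x b) = (if a = b then 1 else 0)"
    using dual_family[of "Suc m" "\<lambda>a. img (w a)" "forms k", OF times poly_comp_add poly_comp_const
        poly_comp_0 lin_indep_on_forms[OF w ik indep]] by auto
  have "img (l * x m) p = 0" if p: "p \<in> forms i" for p
  proof -
    obtain e where "img (l * p) (x m) = (\<Sum>a<m. e a * img (l * c a) (x m))" using spanning[OF p] by blast
    also have "\<dots> = 0"
    proof (intro sum.neutral ballI)
      fix a assume "a \<in> {..<m}"
      then show "e a * img (l * c a) (x m) = 0" using x(2)[of a m] by (simp add: w_def)
    qed
    finally show ?thesis by (simp add: mult_ac)
  qed
  moreover have "l * x m \<in> forms (Suc k)" using x(1)[of m] by (intro mult_form[OF l]) simp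
  moreover have "Suc k + i = d" using ik by simp
  ultimately have "img (l * x m) q = 0" for q using img_eq_0_of_forms by blast
  then have "img (x m) r = 0" using inj x(1)[of m] unfolding injective_at_def by blast
  then show False using x(2)[of m m] by (simp add: w_def mult.commute)
qed

lemma lefschetz_form:
  assumes bound: "\<And>i. i \<le> d \<Longrightarrow> rank_le i (d + 1)"
  shows "\<exists>l\<in>forms 1. \<forall>i<d. injective_at l i \<or> surjective_at l i"
proof (cases "d = 0")
  case True
  then show ?thesis by (intro bexI[of _ 0]) auto
next
  case False
  define j where "j = (d - 1) div 2"
  have "\<exists>l\<in>forms 1. injective_at l j"
  proof (cases "odd d")
    case True
    then have d: "d = Suc (2 * j)" unfolding j_def by presburger
    show ?thesis using bound[of "Suc j"] d by (intro injective_form_odd) auto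
  next
    case False
    with \<open>d \<noteq> 0\<close> have d: "d = 2 * j + 2" unfolding j_def by presburger
    show ?thesis using bound[of "Suc j"] bound[of "j + 2"] d
      by (intro injective_form_even[of j "d + 1"]) (auto simp: numeral_3_eq_3)
  qed
  then obtain l where l: "l \<in> forms 1" "injective_at l j" by blast
  have jd: "j < d" "d \<le> 2 * j + 2" using False unfolding j_def by linarith+
  have inj: "injective_at l i" if "i \<le> j" for i
    using that
  proof (induction rule: inc_induct)
    case base
    then show ?case by (rule l(2))
  next
    case (step i)
    show ?case by (rule injective_at_descend[OF l(1) step.IH]) (use step jd in simp)
  qed
  have "injective_at l i \<or> surjective_at l i" if "i < d" for i
  proof (cases "i \<le> j")
    case True
    then show ?thesis using inj by blast
  next
    case False
    then have "surjective_at l i"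
      using that jd bound by (intro surjective_at_of_injective_at[OF l(1) inj[of "d - Suc i"], where B = "d + 1"]) auto
    then show ?thesis by blast
  qed
  then show ?thesis using l(1) by blast
qed

end

section \<open>The polynomial ring and its homogeneous ideals\<close>

lemma poly_ring_simps [simp]:
  "p \<otimes>\<^bsub>poly_ring n\<^esub> q = p * q" "p \<oplus>\<^bsub>poly_ring n\<^esub> q = p + q"
  "\<one>\<^bsub>poly_ring n\<^esub> = 1" "\<zero>\<^bsub>poly_ring n\<^esub> = 0"
  by (simp_all add: poly_ring_def)

lemma poly_ring_add: "p \<in> carrier (poly_ring n) \<Longrightarrow> q \<in> carrier (poly_ring n) \<Longrightarrow> p + q \<in> carrier (poly_ring n)"
  using Poly_Mapping.keys_add[of p q] by (auto simp: mem_poly_ring_iff)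

lemma poly_ring_mult:
  assumes "p \<in> carrier (poly_ring n)" "q \<in> carrier (poly_ring n)"
  shows "p * q \<in> carrier (poly_ring n)"
  unfolding mem_poly_ring_iff
proof
  fix m assume "m \<in> Poly_Mapping.keys (p * q)"
  then obtain a b where "m = a + b" "a \<in> Poly_Mapping.keys p" "b \<in> Poly_Mapping.keys q"
    using keys_mult[of p q] by blast
  then show "Poly_Mapping.keys m \<subseteq> {..<n}"
    using assms by (auto simp: mem_poly_ring_iff keys_add_nat)
qed

lemma poly_ring_const: "const c \<in> carrier (poly_ring n)"
  by (simp add: mem_poly_ring_iff)

lemma poly_comp_subset: "poly_comp n i \<subseteq> carrier (poly_ring n)"
  by (auto simp: poly_comp_def)

lemma cring_poly_ring: "cring (poly_ring n :: 'k::field mpoly ring)"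
proof (rule cringI)
  show "abelian_group (poly_ring n :: 'k mpoly ring)"
  proof (rule abelian_groupI)
    fix x :: "'k mpoly" assume "x \<in> carrier (poly_ring n)"
    then have "const (- 1) * x \<in> carrier (poly_ring n)"
      by (intro poly_ring_mult poly_ring_const)
    then show "\<exists>y\<in>carrier (poly_ring n). y \<oplus>\<^bsub>poly_ring n\<^esub> x = \<zero>\<^bsub>poly_ring n\<^esub>"
      by (intro bexI[of _ "const (- 1) * x"]) (simp_all add: single_uminus)
  qed (simp_all add: poly_ring_add add_ac, simp add: mem_poly_ring_iff)
  show "comm_monoid (poly_ring n :: 'k mpoly ring)"
    by (rule comm_monoidI) (simp_all add: poly_ring_mult mult_ac, simp add: mem_poly_ring_iff)
qed (simp add: distrib_right)

lemma subfield_constants: "subfield (range const) (poly_ring n :: 'k::field mpoly ring)"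
proof -
  interpret cring "poly_ring n :: 'k mpoly ring" by (rule cring_poly_ring)
  have neg: "\<ominus>\<^bsub>poly_ring n\<^esub> const c = const (- c)" for c :: 'k
    by (rule minus_equality) (simp_all add: poly_ring_const flip: const_add)
  have "subring (range const) (poly_ring n :: 'k mpoly ring)"
  proof (rule subringI)
    show "\<one>\<^bsub>poly_ring n\<^esub> \<in> range const" by (intro image_eqI[of _ _ 1]) simp_all
  qed (auto simp: poly_ring_const neg simp flip: const_add const_mult)
  then have "subcring (range const) (poly_ring n :: 'k mpoly ring)"
    by (intro subcringI) (auto simp: mult.commute)
  moreover have "Units (poly_ring n \<lparr>carrier := range const\<rparr>) = range const - {\<zero>\<^bsub>poly_ring n\<^esub> :: 'k mpoly}"
  proof (intro equalityI subsetI)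
    fix x :: "'k mpoly" assume "x \<in> range const - {\<zero>\<^bsub>poly_ring n\<^esub>}"
    then obtain c where "x = const c" "x \<noteq> 0" by auto
    then have "c \<noteq> 0" by auto
    with \<open>x = const c\<close> have "const (1 / c) * x = 1" by (simp add: mult_single)
    then show "x \<in> Units (poly_ring n \<lparr>carrier := range const\<rparr>)"
      using \<open>x = const c\<close> by (auto simp: Units_def mult.commute intro!: bexI[of _ "const (1 / c)"])
  qed (auto simp: Units_def)
  ultimately show ?thesis by (rule subfieldI)
qed

definition hom_part :: "nat \<Rightarrow> 'k::field mpoly \<Rightarrow> 'k mpoly" where
  "hom_part i p = (\<Sum>m\<in>{m \<in> Poly_Mapping.keys p. mon_degree m = i}. Poly_Mapping.single m (Poly_Mapping.lookup p m))"

lemma lookup_hom_part: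
  "Poly_Mapping.lookup (hom_part i p) m = (if mon_degree m = i then Poly_Mapping.lookup p m else 0)"
  by (auto simp: hom_part_def lookup_sum lookup_single when_def in_keys_iff)

lemma hom_part_add: "hom_part i (p + q) = hom_part i p + hom_part i q"
  by (rule poly_mapping_eqI) (simp add: lookup_hom_part lookup_add)

lemma hom_part_diff: "hom_part i (p - q) = hom_part i p - hom_part i q"
  by (rule poly_mapping_eqI) (simp add: lookup_hom_part lookup_minus)

lemma hom_part_0 [simp]: "hom_part i 0 = 0"
  by (rule poly_mapping_eqI) (simp add: lookup_hom_part)

lemma hom_part_sum: "hom_part i (sum f A) = (\<Sum>x\<in>A. hom_part i (f x))"
  by (induction A rule: infinite_finite_induct) (simp_all add: hom_part_add)

lemma hom_part_poly_comp:
  assumes "p \<in> poly_comp n k"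
  shows "hom_part i p = (if i = k then p else 0)"
proof (rule poly_mapping_eqI)
  fix m
  have "Poly_Mapping.lookup p m = 0 \<or> mon_degree m = k"
    using assms by (auto simp: mem_poly_comp_iff in_keys_iff)
  then show "Poly_Mapping.lookup (hom_part i p) m = Poly_Mapping.lookup (if i = k then p else 0) m"
    by (auto simp: lookup_hom_part)
qed

lemma hom_part_in_poly_comp: "p \<in> carrier (poly_ring n) \<Longrightarrow> hom_part i p \<in> poly_comp n i"
  by (auto simp: mem_poly_comp_iff mem_poly_ring_iff in_keys_iff lookup_hom_part split: if_splits)

lemma sum_hom_part: "p = (\<Sum>k\<in>mon_degree ` Poly_Mapping.keys p. hom_part k p)"
  by (rule poly_mapping_eqI) (auto simp: lookup_sum lookup_hom_part in_keys_iff)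

locale homogeneous_quotient =
  fixes n :: nat and I :: "'k::field mpoly set"
  assumes homogeneous: "homogeneous_ideal n I"
begin

lemma ideal: "ideal I (poly_ring n)"
  using homogeneous by (simp add: homogeneous_ideal_def)

lemma I_carrier: "p \<in> I \<Longrightarrow> p \<in> carrier (poly_ring n)"
  using ideal.Icarr[OF ideal] by blast

lemma I_0: "0 \<in> I"
  using additive_subgroup.zero_closed[OF ideal.axioms(1)[OF ideal]] by simp

lemma I_add: "p \<in> I \<Longrightarrow> q \<in> I \<Longrightarrow> p + q \<in> I"
  using additive_subgroup.a_closed[OF ideal.axioms(1)[OF ideal], of p q] by simp

lemma I_mult: "p \<in> I \<Longrightarrow> q \<in> carrier (poly_ring n) \<Longrightarrow> q * p \<in> I"
  using ideal.I_l_closed[OF ideal, of p q] by simp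

lemma I_minus: "p \<in> I \<Longrightarrow> q \<in> I \<Longrightarrow> p - q \<in> I"
  using I_add[OF _ I_mult[OF _ poly_ring_const[of "- 1"]]] by (simp add: single_uminus)

lemma I_sum: "(\<And>x. x \<in> A \<Longrightarrow> f x \<in> I) \<Longrightarrow> sum f A \<in> I"
  by (induction A rule: infinite_finite_induct) (auto intro: I_0 I_add)

lemma I_const_iff: "c \<noteq> 0 \<Longrightarrow> const c * p \<in> I \<longleftrightarrow> p \<in> I"
  using I_mult[OF _ poly_ring_const[of "1 / c"], of "const c * p"] I_mult[OF _ poly_ring_const[of c], of p]
  by (auto simp: mult_single simp flip: mult.assoc)

text \<open>
  The polynomials all of whose homogeneous parts lie in \<open>I\<close> form an ideal containing the homogeneous
  generators.
\<close>

lemma hom_part_in_I: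
  assumes "p \<in> I" shows "hom_part i p \<in> I"
proof -
  interpret R: cring "poly_ring n :: 'k mpoly ring" by (rule cring_poly_ring)
  obtain S where S: "S \<subseteq> (\<Union>i. poly_comp n i)" "I = Idl\<^bsub>poly_ring n\<^esub> S"
    using homogeneous unfolding homogeneous_ideal_def by blast
  define J where "J = {p \<in> carrier (poly_ring n). \<forall>i. hom_part i p \<in> I}"
  have J_mult: "a * x \<in> J" if a: "a \<in> carrier (poly_ring n)" and x: "x \<in> J" for a x
  proof -
    define t where "t m k = Poly_Mapping.single m (Poly_Mapping.lookup a m) * hom_part k x" for m k
    have "a * x = (\<Sum>m\<in>Poly_Mapping.keys a. \<Sum>k\<in>mon_degree ` Poly_Mapping.keys x. t m k)"
      unfolding t_def sum_product[symmetric]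
      by (simp only: mpoly_eq_sum_single[of a, symmetric] sum_hom_part[of x, symmetric])
    moreover have "hom_part i (t m k) \<in> I" if "m \<in> Poly_Mapping.keys a" for i m k
    proof -
      have s: "Poly_Mapping.single m (Poly_Mapping.lookup a m) \<in> poly_comp n (mon_degree m)"
        using a that by (intro poly_comp_single) (auto simp: mem_poly_ring_iff)
      have "t m k \<in> I"
        unfolding t_def using x s poly_comp_subset by (intro I_mult) (auto simp: J_def)
      moreover have "t m k \<in> poly_comp n (mon_degree m + k)"
        unfolding t_def using s x by (intro poly_comp_mult hom_part_in_poly_comp) (auto simp: J_def)
      ultimately show ?thesis by (simp add: hom_part_poly_comp I_0)
    qed
    ultimately show ?thesis
      using a x poly_ring_mult[of a n x] by (auto simp: J_def hom_part_sum intro!: I_sum)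
  qed
  have "ideal J (poly_ring n)"
  proof (rule idealI)
    show "subgroup J (add_monoid (poly_ring n))"
    proof (rule R.add.subgroupI)
      show "J \<noteq> {}" using I_0 I_carrier by (force simp: J_def)
      fix x assume x: "x \<in> J"
      have "\<ominus>\<^bsub>poly_ring n\<^esub> x = const (- 1) * x"
        using x poly_ring_mult[OF poly_ring_const[of "- 1 :: 'k"], of x n]
        by (intro R.minus_equality) (auto simp: J_def single_uminus)
      then show "\<ominus>\<^bsub>poly_ring n\<^esub> x \<in> J" using J_mult[OF poly_ring_const x, of "- 1"] by simp
    qed (auto simp: J_def hom_part_add intro: I_add poly_ring_add)
    show "x \<otimes>\<^bsub>poly_ring n\<^esub> a \<in> J" "a \<otimes>\<^bsub>poly_ring n\<^esub> x \<in> J"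
      if "a \<in> J" "x \<in> carrier (poly_ring n)" for a x
      using J_mult[OF that(2,1)] by (simp_all add: mult.commute)
  qed (rule R.ring_axioms)
  moreover have "S \<subseteq> J"
  proof
    fix s assume s: "s \<in> S"
    with S obtain k where k: "s \<in> poly_comp n k" by blast
    have "S \<subseteq> carrier (poly_ring n)" using S(1) poly_comp_subset by blast
    then have "s \<in> I" using s R.genideal_self S(2) by blast
    then show "s \<in> J" using k I_carrier by (auto simp: J_def hom_part_poly_comp I_0)
  qed
  ultimately have "I \<subseteq> J" unfolding S(2) by (rule R.genideal_minimal)
  then show ?thesis using assms by (auto simp: J_def)
qed

section \<open>Cosets\<close>

abbreviation coset :: "'k mpoly \<Rightarrow> 'k mpoly set" where
  "coset p \<equiv> I +>\<^bsub>poly_ring n\<^esub> p"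

lemma coset_eq_iff: "coset p = coset q \<longleftrightarrow> p - q \<in> I"
proof -
  have eq: "coset p = {h + p |h. h \<in> I}" for p by (auto simp: a_r_coset_def')
  show ?thesis
  proof
    assume "coset p = coset q"
    moreover have "p \<in> coset p" unfolding eq using I_0 by force
    ultimately show "p - q \<in> I" unfolding eq by auto
  next
    assume pq: "p - q \<in> I"
    show "coset p = coset q"
      unfolding eq
    proof (intro equalityI subsetI; clarify)
      show "\<exists>h'. h + p = h' + q \<and> h' \<in> I" if "h \<in> I" for h
        using I_add[OF that pq] by (intro exI[of _ "h + (p - q)"]) simp
      show "\<exists>h'. h + q = h' + p \<and> h' \<in> I" if "h \<in> I" for h
        using I_minus[OF that pq] by (intro exI[of _ "h - (p - q)"]) simp
    qed
  qed
qed

sublocale quot: ring_hom_ring "poly_ring n" "quot_alg n I" coset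
  by (rule ideal.rcos_ring_hom_ring[OF ideal])

lemma quot_zero: "\<zero>\<^bsub>quot_alg n I\<^esub> = coset 0"
  using quot.hom_zero by simp

lemma coset_eq_zero_iff: "coset p = \<zero>\<^bsub>quot_alg n I\<^esub> \<longleftrightarrow> p \<in> I"
  unfolding quot_zero coset_eq_iff by simp

lemma coset_mult:
  "p \<in> carrier (poly_ring n) \<Longrightarrow> q \<in> carrier (poly_ring n) \<Longrightarrow>
     coset p \<otimes>\<^bsub>quot_alg n I\<^esub> coset q = coset (p * q)"
  using quot.hom_mult[of p q] by simp

lemma coset_add:
  "p \<in> carrier (poly_ring n) \<Longrightarrow> q \<in> carrier (poly_ring n) \<Longrightarrow>
     coset p \<oplus>\<^bsub>quot_alg n I\<^esub> coset q = coset (p + q)"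
  using quot.hom_add[of p q] by simp

lemma scalars_eq: "scalars n I = coset ` range const"
  by (simp add: scalars_def image_image)

lemma graded_comp_eq_zero_iff:
  "graded_comp n I i = {\<zero>\<^bsub>quot_alg n I\<^esub>} \<longleftrightarrow> poly_comp n i \<subseteq> I"
proof -
  have "f ` A = {z} \<longleftrightarrow> A \<noteq> {} \<and> (\<forall>a\<in>A. f a = z)" for f :: "'k mpoly \<Rightarrow> 'k mpoly set" and A z
    by auto
  moreover have "poly_comp n i \<noteq> ({} :: 'k mpoly set)" using poly_comp_0 by blast
  ultimately show ?thesis by (simp add: graded_comp_def coset_eq_zero_iff subset_eq)
qed

end

section \<open>The dual generator of a Gorenstein quotient\<close>

abbreviation var :: "nat \<Rightarrow> 'k::field mpoly" where
  "var a \<equiv> Poly_Mapping.single (Poly_Mapping.single a 1) 1"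

lemma var_in_forms: "a < n \<Longrightarrow> var a \<in> poly_comp n 1"
  by (intro poly_comp_single) auto

locale gorenstein_quotient = homogeneous_quotient n I
  for n and I :: "'k::field_char_0 mpoly set" +
  fixes d :: nat
  assumes artinian: "artinian_quot n I"
    and socle_degree: "is_socle_degree n I d"
    and gorenstein: "gorenstein_quot n I d"
begin

lemma forms_above: "d < j \<Longrightarrow> poly_comp n j \<subseteq> I"
  using socle_degree by (simp add: is_socle_degree_def graded_comp_eq_zero_iff)

lemma forms_top: "\<not> poly_comp n d \<subseteq> I"
  using socle_degree by (simp add: is_socle_degree_def graded_comp_eq_zero_iff)

lemma subfield_scalars: "subfield (scalars n I) (quot_alg n I)"
proof -
  have "1 \<notin> I"
  proof
    assume "1 \<in> I"
    then have "p \<in> I" if "p \<in> poly_comp n d" for p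
      using I_mult[of 1 p] that poly_comp_subset by auto
    then show False using forms_top by blast
  qed
  then have "\<one>\<^bsub>quot_alg n I\<^esub> \<noteq> \<zero>\<^bsub>quot_alg n I\<^esub>"
    using quot.hom_one by (simp flip: coset_eq_zero_iff)
  then show ?thesis
    unfolding scalars_eq by (rule quot.img_is_subfield(2)[OF subfield_constants])
qed

text \<open>
  It suffices to test against variables, because they generate the polynomials without constant term.
\<close>

lemma coset_in_socle:
  assumes p: "p \<in> carrier (poly_ring n)" and van: "\<And>a. a < n \<Longrightarrow> var a * p \<in> I"
  shows "coset p \<in> socle n I"
proof -
  have "q * p \<in> I" if q: "q \<in> carrier (poly_ring n)" "Poly_Mapping.lookup q 0 = 0" for q
  proof -
    have "Poly_Mapping.single m c * p \<in> I" if m: "m \<in> Poly_Mapping.keys q" for m and c :: 'k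
    proof -
      have "m \<noteq> 0" using m q(2) by (auto simp: in_keys_iff)
      then have deg: "mon_degree m = Suc (mon_degree m - 1)"
        using mon_degree_eq_0_iff[of m] by simp
      have "Poly_Mapping.keys m \<subseteq> {..<n}" using m q(1) by (auto simp: mem_poly_ring_iff)
      from monomial_factor[OF deg this] obtain a m' where
        a: "a < n" "m = Poly_Mapping.single a 1 + m'" "Poly_Mapping.keys m' \<subseteq> {..<n}" by metis
      have "Poly_Mapping.single m c * p = Poly_Mapping.single m' c * (var a * p)"
        unfolding a(2) by (simp add: mult_single add.commute flip: mult.assoc)
      moreover have "Poly_Mapping.single m' c \<in> carrier (poly_ring n)"
        using a(3) by (auto simp: mem_poly_ring_iff)
      ultimately show ?thesis using I_mult[OF van[OF a(1)]] by metis
    qed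
    then have "(\<Sum>m\<in>Poly_Mapping.keys q. Poly_Mapping.single m (Poly_Mapping.lookup q m) * p) \<in> I"
      by (intro I_sum) auto
    then show ?thesis
      by (simp only: sum_distrib_right[symmetric] mpoly_eq_sum_single[of q, symmetric])
  qed
  then show ?thesis
    using p by (auto simp: socle_def irrelevant_ideal_def coset_mult coset_eq_zero_iff)
qed

lemma graded_comp_top_subset_socle: "graded_comp n I d \<subseteq> socle n I"
proof -
  have "coset r \<in> socle n I" if r: "r \<in> poly_comp n d" for r
  proof (rule coset_in_socle)
    show "r \<in> carrier (poly_ring n)" using r poly_comp_subset by blast
    show "var a * r \<in> I" if "a < n" for a
      using poly_comp_mult[OF var_in_forms[OF that] r] forms_above[of "1 + d"] by auto
  qed
  then show ?thesis by (auto simp: graded_comp_def)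
qed

lemma top_forms_one_dimensional:
  "\<exists>s\<in>poly_comp n d. \<forall>r\<in>poly_comp n d. \<exists>c. r - const c * s \<in> I"
proof -
  have "quot.S.dimension 1 (scalars n I) (socle n I)"
    using gorenstein by (simp add: gorenstein_quot_def)
  from quot.S.exists_base[OF subfield_scalars this] obtain u where
    u: "u \<in> carrier (quot_alg n I)" "quot.S.Span (scalars n I) [u] = socle n I"
    by (metis One_nat_def length_0_conv length_Suc_conv list.set_intros(1) subsetD)
  have "u \<in> socle n I"
    using quot.S.Span_base_incl[OF subfield_scalars, of "[u]"] u by (simp del: quot.S.Span.simps)
  then have "u \<in> graded_comp n I d" using gorenstein by (auto simp: gorenstein_quot_def)
  then obtain s where s: "s \<in> poly_comp n d" "u = coset s" by (auto simp: graded_comp_def)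
  have "\<exists>c. r - const c * s \<in> I" if r: "r \<in> poly_comp n d" for r
  proof -
    have "coset r \<in> quot.S.Span (scalars n I) [u]"
      using graded_comp_top_subset_socle r unfolding u(2) by (auto simp: graded_comp_def)
    then obtain k where k: "k \<in> scalars n I" "coset r = k \<otimes>\<^bsub>quot_alg n I\<^esub> u \<oplus>\<^bsub>quot_alg n I\<^esub> coset 0"
      unfolding quot_zero[symmetric] by (auto simp: quot.S.line_extension_mem_iff)
    then obtain c where "k = coset (const c)" by (auto simp: scalars_eq)
    moreover have sc: "s \<in> carrier (poly_ring n)" using s(1) poly_comp_subset by blast
    moreover have "0 \<in> carrier (poly_ring n :: 'k mpoly ring)" by (simp add: mem_poly_ring_iff)
    ultimately have "coset r = coset (const c * s)"
      unfolding k(2) s(2)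
      using coset_mult[OF poly_ring_const sc, of c] coset_add[OF poly_ring_mult[OF poly_ring_const sc], of 0 c]
      by simp
    then show ?thesis by (auto simp: coset_eq_iff)
  qed
  with s(1) show ?thesis by blast
qed

text \<open>
  The top degree of the algebra is a line, so reading off coefficients with respect to a basis
  element \<open>s\<close> is a functional on the forms of degree \<open>d\<close>; it is extended by zero to all other monomials.
\<close>

lemma dual_generator_exists:
  "\<exists>\<phi>. dual_generator \<phi> n d \<and> (\<forall>r\<in>poly_comp n d. \<phi> r = 0 \<longleftrightarrow> r \<in> I)"
proof -
  obtain s where s: "s \<in> poly_comp n d" "\<And>r. r \<in> poly_comp n d \<Longrightarrow> \<exists>c. r - const c * s \<in> I"
    using top_forms_one_dimensional by blast
  define top where "top m \<longleftrightarrow> mon_degree m = d \<and> Poly_Mapping.keys m \<subseteq> {..<n}" for m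
  define F where "F m = (if top m then SOME c. Poly_Mapping.single m 1 - const c * s \<in> I else 0)" for m
  define \<phi> where "\<phi> p = (\<Sum>m\<in>Poly_Mapping.keys p. Poly_Mapping.lookup p m * F m)" for p
  have F: "Poly_Mapping.single m 1 - const (F m) * s \<in> I" if "top m" for m
    using someI_ex[OF s(2)[of "Poly_Mapping.single m 1"]] that
    by (auto simp: F_def top_def poly_comp_single)
  have \<phi>_superset: "\<phi> p = (\<Sum>m\<in>A. Poly_Mapping.lookup p m * F m)"
    if "finite A" "Poly_Mapping.keys p \<subseteq> A" for A p
    unfolding \<phi>_def using that by (intro sum.mono_neutral_left) (auto simp: in_keys_iff)
  have "dual_generator \<phi> n d"
  proof unfold_locales
    fix p q :: "'k mpoly"
    let ?A = "Poly_Mapping.keys p \<union> Poly_Mapping.keys q"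
    have "\<phi> (p + q) = (\<Sum>m\<in>?A. Poly_Mapping.lookup p m * F m + Poly_Mapping.lookup q m * F m)"
      using Poly_Mapping.keys_add[of p q] by (subst \<phi>_superset[of ?A]) (auto simp: lookup_add distrib_right)
    also have "\<dots> = \<phi> p + \<phi> q"
      by (simp add: sum.distrib \<phi>_superset[of ?A p] \<phi>_superset[of ?A q])
    finally show "\<phi> (p + q) = \<phi> p + \<phi> q" .
  next
    fix c and p :: "'k mpoly"
    have "Poly_Mapping.keys (const c * p) \<subseteq> Poly_Mapping.keys p" by (auto simp: in_keys_iff)
    then have "\<phi> (const c * p) = (\<Sum>m\<in>Poly_Mapping.keys p. c * (Poly_Mapping.lookup p m * F m))"
      by (subst \<phi>_superset[of "Poly_Mapping.keys p"]) (auto simp: mult.assoc)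
    then show "\<phi> (const c * p) = c * \<phi> p" by (simp add: \<phi>_def sum_distrib_left)
  next
    fix m and c :: 'k assume "\<phi> (Poly_Mapping.single m c) \<noteq> 0"
    then have "F m \<noteq> 0" by (auto simp: \<phi>_def split: if_splits)
    then show "mon_degree m = d \<and> Poly_Mapping.keys m \<subseteq> {..<n}"
      by (auto simp: F_def top_def split: if_splits)
  qed
  moreover have "\<phi> r = 0 \<longleftrightarrow> r \<in> I" if r: "r \<in> poly_comp n d" for r
  proof -
    interpret dual_generator \<phi> n d by fact
    have "(\<Sum>m\<in>Poly_Mapping.keys r. const (Poly_Mapping.lookup r m) * (Poly_Mapping.single m 1 - const (F m) * s)) \<in> I"
      using r F by (intro I_sum I_mult poly_ring_const) (auto simp: top_def mem_poly_comp_iff)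
    also have "(\<Sum>m\<in>Poly_Mapping.keys r. const (Poly_Mapping.lookup r m) * (Poly_Mapping.single m 1 - const (F m) * s))
        = r - const (\<phi> r) * s"
    proof -
      have "const (\<phi> r) = (\<Sum>m\<in>Poly_Mapping.keys r. const (Poly_Mapping.lookup r m * F m))"
        unfolding \<phi>_def by (induction rule: infinite_finite_induct) (simp_all add: const_add)
      moreover have "r = (\<Sum>m\<in>Poly_Mapping.keys r. const (Poly_Mapping.lookup r m) * Poly_Mapping.single m 1)"
        by (simp add: mult_single flip: mpoly_eq_sum_single)
      ultimately show ?thesis
        by (simp add: right_diff_distrib sum_subtractf sum_distrib_right const_mult mult.assoc del: mult_single)
    qed
    finally have diff: "r - const (\<phi> r) * s \<in> I" .
    have "s \<notin> I"
    proof
      assume "s \<in> I"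
      then have "r \<in> I" if "r \<in> poly_comp n d" for r
      proof -
        from s(2)[OF that] obtain c where "r - const c * s \<in> I" by blast
        from I_add[OF this I_mult[OF \<open>s \<in> I\<close> poly_ring_const[of c]]] show ?thesis by simp
      qed
      then show False using forms_top by blast
    qed
    show ?thesis
    proof
      assume "\<phi> r = 0"
      then show "r \<in> I" using diff by simp
    next
      assume "r \<in> I"
      from I_minus[OF this diff] have "const (\<phi> r) * s \<in> I" by simp
      with \<open>s \<notin> I\<close> show "\<phi> r = 0" using I_const_iff by blast
    qed
  qed
  ultimately show ?thesis by blast
qed

text \<open>
  For the nontrivial direction, descend from degree \<open>d\<close>: if all multiples of \<open>p\<close> by variables lie in
  \<open>I\<close>, then \<open>p\<close> represents a socle element, and the socle is concentrated in degree \<open>d\<close>.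
\<close>

lemma forms_in_I_iff:
  assumes "dual_generator \<phi> n d" and top: "\<And>r. r \<in> poly_comp n d \<Longrightarrow> \<phi> r = 0 \<longleftrightarrow> r \<in> I"
    and p: "p \<in> poly_comp n i"
  shows "p \<in> I \<longleftrightarrow> (\<forall>q. \<phi> (p * q) = 0)"
proof -
  interpret dual_generator \<phi> n d by fact
  show ?thesis
  proof
    assume "p \<in> I"
    show "\<forall>q. \<phi> (p * q) = 0"
    proof (rule allI, rule img_eq_0_of_monomials[OF p])
      fix m assume m: "mon_degree m + i = d" "Poly_Mapping.keys m \<subseteq> {..<n}"
      have x: "Poly_Mapping.single m (1::'k) \<in> poly_comp n (mon_degree m)" using m by (intro poly_comp_single) auto
      then have "Poly_Mapping.single m 1 * p \<in> I"
        using poly_comp_subset by (intro I_mult[OF \<open>p \<in> I\<close>]) blast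
      moreover have "Poly_Mapping.single m 1 * p \<in> poly_comp n d"
        using poly_comp_mult[OF x p] m(1) by simp
      ultimately show "\<phi> (p * Poly_Mapping.single m 1) = 0" using top by (simp add: mult.commute)
    qed
  next
    assume "\<forall>q. \<phi> (p * q) = 0"
    then show "p \<in> I"
      using p
    proof (induction "d - i" arbitrary: p i)
      case 0
      show ?case
      proof (cases "i = d")
        case True
        then show ?thesis using 0 top[of p] by (metis mult.right_neutral)
      next
        case False
        with 0 forms_above[of i] show ?thesis by auto
      qed
    next
      case (Suc k)
      have "coset p \<in> socle n I"
      proof (rule coset_in_socle)
        show "p \<in> carrier (poly_ring n)" using Suc.prems poly_comp_subset by blast
        fix a assume "a < n"
        show "var a * p \<in> I"
        proof (rule Suc.hyps(1)[of "Suc i"])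
          show "var a * p \<in> poly_comp n (Suc i)"
            using mult_form[OF var_in_forms[OF \<open>a < n\<close>] Suc.prems(2)] .
          show "\<forall>q. \<phi> (var a * p * q) = 0"
            using Suc.prems(1) by (metis mult.assoc mult.commute)
        qed (use Suc.hyps(2) in simp)
      qed
      then have "coset p \<in> graded_comp n I d" using gorenstein by (auto simp: gorenstein_quot_def)
      then obtain r where r: "r \<in> poly_comp n d" "p - r \<in> I"
        by (auto simp: graded_comp_def coset_eq_iff)
      have "hom_part i (p - r) = p"
        using Suc.hyps(2) hom_part_poly_comp[OF Suc.prems(2), of i] hom_part_poly_comp[OF r(1), of i]
        by (auto simp: hom_part_diff)
      then show "p \<in> I" using hom_part_in_I[OF r(2), of i] by simp
    qed
  qed
qed

lemma finite_dimension_graded_comp: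
  "ring.finite_dimension (quot_alg n I) (scalars n I) (graded_comp n I i)"
proof -
  have neg: "\<ominus>\<^bsub>poly_ring n\<^esub> p = const (- 1) * p" if "p \<in> carrier (poly_ring n)" for p :: "'k mpoly"
    using that poly_ring_mult[OF poly_ring_const[of "- 1 :: 'k"] that]
    by (intro quot.R.minus_equality) (auto simp: single_uminus)
  have "subalgebra (range const) (poly_comp n i) (poly_ring n :: 'k mpoly ring)"
  proof (intro subalgebra.intro subalgebra_axioms.intro quot.R.add.subgroupI)
    show "\<ominus>\<^bsub>poly_ring n\<^esub> p \<in> poly_comp n i" if "p \<in> poly_comp n i" for p :: "'k mpoly"
      using neg[OF subsetD[OF poly_comp_subset that]] poly_comp_const[OF that, of "- 1"] by simp
    show "poly_comp n i \<noteq> ({} :: 'k mpoly set)" using poly_comp_0 by blast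
  qed (use poly_comp_subset in \<open>auto intro: poly_comp_add poly_comp_const\<close>)
  then have sub: "subalgebra (scalars n I) (graded_comp n I i) (quot_alg n I)"
    unfolding scalars_eq graded_comp_def
    by (intro quot.img_is_subalgebra) (auto simp: poly_ring_const)
  have fin: "quot.S.finite_dimension (scalars n I) (carrier (quot_alg n I))"
    using artinian unfolding artinian_quot_def .
  show ?thesis
    by (rule quot.S.subalbegra_incl_imp_finite_dimension[OF subfield_scalars fin sub])
      (rule quot.S.subalgebra_in_carrier[OF sub])
qed

text \<open>
  A relation between cosets is a form in \<open>I\<close>, hence a relation between contractions.
\<close>

lemma rank_le_hilb:
  assumes dg: "dual_generator \<phi> n d" and top: "\<And>r. r \<in> poly_comp n d \<Longrightarrow> \<phi> r = 0 \<longleftrightarrow> r \<in> I"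
  shows "dual_generator.rank_le \<phi> n i (hilb n I i)"
proof -
  interpret dual_generator \<phi> n d by fact
  show ?thesis
    unfolding rank_le_def
  proof (intro allI impI)
    fix m v assume v: "\<forall>a<m. v a \<in> poly_comp n i" and indep: "lin_indep m (\<lambda>a. img (v a))"
    define us where "us = map (\<lambda>a. coset (v a)) [0..<m]"
    have vc: "v a \<in> carrier (poly_ring n)" if "a < m" for a using v that poly_comp_subset by blast
    have us: "set us \<subseteq> graded_comp n I i" "set us \<subseteq> carrier (quot_alg n I)"
      using v vc quot.hom_closed by (auto simp: us_def graded_comp_def)
    have combine: "quot.S.combine (map (\<lambda>a. coset (const (c a))) as) (map (\<lambda>a. coset (v a)) as)
        = coset (\<Sum>a\<leftarrow>as. const (c a) * v a) \<and> (\<Sum>a\<leftarrow>as. const (c a) * v a) \<in> carrier (poly_ring n)"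
      if "set as \<subseteq> {..<m}" for as c
      using that
      by (induction as)
        (auto simp: quot_zero coset_mult coset_add vc poly_ring_const poly_ring_mult poly_ring_add mem_poly_ring_iff[of 0])
    have "quot.S.independent (scalars n I) us"
    proof (rule ccontr)
      assume "\<not> ?thesis"
      then obtain ks where ks: "length ks = length us" "quot.S.combine ks us = \<zero>\<^bsub>quot_alg n I\<^esub>"
          "set ks \<subseteq> scalars n I" "set ks \<noteq> {\<zero>\<^bsub>quot_alg n I\<^esub>}"
        using quot.S.dependent_imp_non_trivial_combine[OF subfield_scalars us(2)] by blast
      have "\<exists>c. ks ! a = coset (const c)" if "a < m" for a
      proof -
        have "ks ! a \<in> scalars n I" using ks(1,3) that by (auto simp: us_def)
        then show ?thesis by (auto simp: scalars_eq)
      qed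
      then obtain c where c: "\<And>a. a < m \<Longrightarrow> ks ! a = coset (const (c a))" by metis
      have ks_eq: "ks = map (\<lambda>a. coset (const (c a))) [0..<m]"
        using ks(1) c by (intro nth_equalityI) (auto simp: us_def)
      have "coset (\<Sum>a<m. const (c a) * v a) = \<zero>\<^bsub>quot_alg n I\<^esub>"
        using ks(2) combine[of "[0..<m]" c] unfolding ks_eq us_def
        by (auto simp: interv_sum_list_conv_sum_set_nat atLeast0LessThan)
      then have "(\<Sum>a<m. const (c a) * v a) \<in> I" by (simp add: coset_eq_zero_iff)
      moreover have "(\<Sum>a<m. const (c a) * v a) \<in> poly_comp n i"
        using v by (intro poly_comp_sum poly_comp_const) auto
      ultimately have "img (\<Sum>a<m. const (c a) * v a) q = 0" for q
        using forms_in_I_iff[OF dg top] by blast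
      then have "(\<Sum>a<m. c a * img (v a) q) = 0" for q by (simp add: img_combination)
      from lin_indep_onD[OF indep this] have "c a = 0" if "a < m" for a using that by blast
      then have "set ks \<subseteq> {\<zero>\<^bsub>quot_alg n I\<^esub>}" unfolding ks_eq by (auto simp: quot_zero)
      then have "ks = []" using ks(4) by (cases ks) auto
      then have "us = []" using ks(1) by simp
      with \<open>\<not> quot.S.independent (scalars n I) us\<close> show False by simp
    qed
    with quot.S.finite_dimensionE[OF subfield_scalars finite_dimension_graded_comp[of i]] us(1)
    have "length us \<le> hilb n I i"
      unfolding hilb_def by (intro quot.S.independent_length_le_dimension[OF subfield_scalars]) (auto simp: over_def)
    then show "m \<le> hilb n I i" by (simp add: us_def)
  qed
qed

lemma weak_lefschetz_if_sperner_le: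
  assumes sperner: "sperner_number n I d \<le> d + 1"
  shows "weak_lefschetz n I"
proof -
  obtain \<phi> where dg: "dual_generator \<phi> n d" and top: "\<And>r. r \<in> poly_comp n d \<Longrightarrow> \<phi> r = 0 \<longleftrightarrow> r \<in> I"
    using dual_generator_exists by blast
  interpret dual_generator \<phi> n d by fact
  note mem_I = forms_in_I_iff[OF dg top]
  have "rank_le i (d + 1)" if "i \<le> d" for i
  proof -
    have "hilb n I i \<le> d + 1"
      using sperner that unfolding sperner_number_def by (subst (asm) Max_le_iff) auto
    then show ?thesis using rank_le_hilb[OF dg top, of i] unfolding rank_le_def by (meson le_trans)
  qed
  then obtain l where l: "l \<in> forms 1" and max: "\<And>i. i < d \<Longrightarrow> injective_at l i \<or> surjective_at l i"
    using lefschetz_form by blast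
  have carrier: "p \<in> carrier (poly_ring n)" if "p \<in> forms i" for p :: "'k mpoly" and i
    using that poly_comp_subset by blast
  have mult: "coset l \<otimes>\<^bsub>quot_alg n I\<^esub> coset p = coset (l * p)" if "p \<in> forms i" for p i
    using that l by (intro coset_mult carrier)
  have into: "(\<lambda>a. coset l \<otimes>\<^bsub>quot_alg n I\<^esub> a) ` graded_comp n I i \<subseteq> graded_comp n I (Suc i)" for i
    using mult_form[OF l] by (auto simp: graded_comp_def mult)
  have "inj_on (\<lambda>a. coset l \<otimes>\<^bsub>quot_alg n I\<^esub> a) (graded_comp n I i) \<or>
      (\<lambda>a. coset l \<otimes>\<^bsub>quot_alg n I\<^esub> a) ` graded_comp n I i = graded_comp n I (Suc i)" for i
  proof -
    consider "d \<le> i" | "i < d" "injective_at l i" | "i < d" "surjective_at l i"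
      using max[of i] by linarith
    then show ?thesis
    proof cases
      case 1
      then have "graded_comp n I (Suc i) = {\<zero>\<^bsub>quot_alg n I\<^esub>}"
        using forms_above by (simp add: graded_comp_eq_zero_iff)
      moreover have "graded_comp n I i \<noteq> {}" using poly_comp_0[of n i] unfolding graded_comp_def by blast
      ultimately show ?thesis using into[of i] by (metis image_is_empty subset_singletonD)
    next
      case 2
      have "coset p = coset q"
        if pq: "p \<in> forms i" "q \<in> forms i" "coset (l * p) = coset (l * q)" for p q
      proof -
        have diff: "p - q \<in> forms i" using pq by (intro poly_comp_minus)
        have "l * (p - q) \<in> I" using pq(3) by (simp add: coset_eq_iff right_diff_distrib)
        then have "\<forall>r. \<phi> (l * (p - q) * r) = 0" using mem_I mult_form[OF l diff] by blast
        then have "\<forall>r. \<phi> ((p - q) * r) = 0" using 2(2) diff unfolding injective_at_def by blast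
        then show ?thesis using mem_I diff by (simp add: coset_eq_iff)
      qed
      note cancel = this
      have "inj_on (\<lambda>a. coset l \<otimes>\<^bsub>quot_alg n I\<^esub> a) (graded_comp n I i)"
      proof (rule inj_onI)
        fix x y assume xy: "x \<in> graded_comp n I i" "y \<in> graded_comp n I i"
          and eq: "coset l \<otimes>\<^bsub>quot_alg n I\<^esub> x = coset l \<otimes>\<^bsub>quot_alg n I\<^esub> y"
        from xy obtain p q where p: "p \<in> forms i" "x = coset p" and q: "q \<in> forms i" "y = coset q"
          unfolding graded_comp_def by blast
        have "coset (l * p) = coset (l * q)"
          using eq unfolding p(2) q(2) mult[OF p(1)] mult[OF q(1)] .
        from cancel[OF p(1) q(1) this] show "x = y" unfolding p(2) q(2) .
      qed
      then show ?thesis ..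
    next
      case 3
      have "coset r \<in> (\<lambda>a. coset l \<otimes>\<^bsub>quot_alg n I\<^esub> a) ` graded_comp n I i" if r: "r \<in> forms (Suc i)" for r
      proof -
        obtain p where p: "p \<in> forms i" "\<And>q. \<phi> (r * q) = \<phi> (l * p * q)"
          using 3(2) r unfolding surjective_at_def by blast
        have "r - l * p \<in> forms (Suc i)" using r p(1) mult_form[OF l] by (intro poly_comp_minus)
        moreover have "\<phi> ((r - l * p) * q) = 0" for q using p(2) by (simp add: left_diff_distrib diff)
        ultimately have "r - l * p \<in> I" using mem_I by blast
        then have "coset r = coset l \<otimes>\<^bsub>quot_alg n I\<^esub> coset p" by (simp add: mult[OF p(1)] coset_eq_iff)
        then show ?thesis using p(1) by (auto simp: graded_comp_def)
      qed
      then have "graded_comp n I (Suc i) \<subseteq> (\<lambda>a. coset l \<otimes>\<^bsub>quot_alg n I\<^esub> a) ` graded_comp n I i"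
        unfolding graded_comp_def[of n I "Suc i"] by blast
      then show ?thesis using into[of i] by blast
    qed
  qed
  moreover have "coset l \<in> graded_comp n I 1" using l by (auto simp: graded_comp_def)
  ultimately show ?thesis unfolding weak_lefschetz_def by blast
qed

end

section \<open>The weak Lefschetz property\<close>

theorem theorem1p1:
  fixes n d :: nat
    and I :: "'k::{alg_closed_field, field_char_0} mpoly set"
  assumes "homogeneous_ideal n I"
    and "artinian_quot n I"
    and "is_socle_degree n I d"
    and "gorenstein_quot n I d"
    and "sperner_number n I d \<le> d + 1"
  shows "weak_lefschetz n I"
proof -
  interpret gorenstein_quotient n I d
    using assms by unfold_locales
  show ?thesis by (rule weak_lefschetz_if_sperner_le[OF assms(5)])
qed

end
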